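(* There is a polynomial-time reduction from (the decision version of) the ordered unrelated machines scheduling problem to (the decision version of) the joint cache partition and job assignment problem.
   Context: Ordered unrelated machines scheduling: there are $c$ machines $1,\dots,c$ and a set of $n$ jobs; the input is a matrix $T(i,j)>0$ giving the running time of job $j$ on machine $i$, such that for any machines $i_1<i_2$ and any job $j$, $T(i_1,j)\ge T(i_2,j)$. A schedule assigns each job to a machine; its makespan is the maximum over machines of the sum of running times of the jobs assigned to it. The decision version asks, given also a number $M$, whether there is a schedule of makespan at most $M$. Joint cache partition and job assignment problem: an instance consists of a number $c$ of cores, a total cache size $K$, and a finite set $J$ of jobs, where each job $j$ is given by a non-increasing function $T_j(x)\in(0,\infty]$ giving its running time on a core with $x$ cache. A solution is a cache partition $p$ assigning $p(i)\ge 0$ cache to each core $i$ with $\sum_{i=1}^c p(i)\le K$, together with a job assignment $S:J\to\{1,\dots,c\}$. Its makespan is $\max_i\sum_{j:S(j)=i}T_j(p(i))$. The decision version asks, given also a number $M'$, whether there is a solution of makespan at most $M'$. *)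

theory Defs
  imports
    "HOL-Analysis.Analysis"
    "HOL-Computational_Algebra.Polynomial"
begin

section \<open>Deterministic multi-tape Turing machines\<close>

datatype 'a cell = Blank | Input 'a | Work nat

datatype dir = Left | Stay | Right

text \<open>
  States are numbers, \<open>0\<close> is the initial state and \<open>states M\<close> is the only halting state.
  Besides the blank and the (finite) input alphabet, a machine may use the auxiliary symbols
  \<open>Work 0, \<dots>, Work (work_symbols M - 1)\<close>. The transition function maps a non-halting state and
  the list of symbols under the heads to a new state and, for each tape, the symbol written
  and the head movement.
\<close>

record 'a tm =
  tapes :: nat
  states :: nat
  work_symbols :: nat
  delta :: "nat \<Rightarrow> 'a cell list \<Rightarrow> nat \<times> ('a cell \<times> dir) list"

definition tape_alphabet :: "'a tm \<Rightarrow> 'a cell set" where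
  "tape_alphabet M = {Blank} \<union> range Input \<union> Work ` {..<work_symbols M}"

definition wf_tm :: "('a::finite) tm \<Rightarrow> bool" where
  "wf_tm M \<longleftrightarrow> 0 < tapes M \<and>
     (\<forall>q < states M. \<forall>xs. length xs = tapes M \<and> set xs \<subseteq> tape_alphabet M \<longrightarrow>
        fst (delta M q xs) \<le> states M \<and>
        length (snd (delta M q xs)) = tapes M \<and>
        fst ` set (snd (delta M q xs)) \<subseteq> tape_alphabet M)"

text \<open>
  In a tape \<open>(ls, rs)\<close> the head stands on the first cell of \<open>rs\<close>, and \<open>ls\<close> lists the cells
  to its left, nearest first. All cells not listed are blank.
\<close>

type_synonym 'a tape = "'a cell list \<times> 'a cell list"

definition head_of :: "'a cell list \<Rightarrow> 'a cell" where
  "head_of xs = (case xs of [] \<Rightarrow> Blank | x # _ \<Rightarrow> x)"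

fun move :: "dir \<Rightarrow> 'a tape \<Rightarrow> 'a tape" where
  "move Left (ls, rs) = (tl ls, head_of ls # rs)"
| "move Stay (ls, rs) = (ls, rs)"
| "move Right (ls, rs) = (head_of rs # ls, tl rs)"

fun act :: "'a cell \<times> dir \<Rightarrow> 'a tape \<Rightarrow> 'a tape" where
  "act (x, d) (ls, rs) = move d (ls, x # tl rs)"

type_synonym 'a config = "nat \<times> 'a tape list"

definition tm_step :: "'a tm \<Rightarrow> 'a config \<Rightarrow> 'a config" where
  "tm_step M cfg = (case cfg of (q, ts) \<Rightarrow>
     if q \<ge> states M then (q, ts)
     else (case delta M q (map (head_of \<circ> snd) ts) of
             (q', as) \<Rightarrow> (q', map2 act as ts)))"

definition tm_init :: "'a tm \<Rightarrow> 'a list \<Rightarrow> 'a config" where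
  "tm_init M w = (0, ([], map Input w) # replicate (tapes M - 1) ([], []))"

text \<open>
  The output is what stands on the last tape from the head up to the first blank.
\<close>

definition tm_output :: "'a config \<Rightarrow> 'a cell list" where
  "tm_output cfg = takeWhile (\<lambda>x. x \<noteq> Blank) (snd (last (snd cfg)))"

definition computes_within :: "'a tm \<Rightarrow> 'a list \<Rightarrow> 'a list \<Rightarrow> nat \<Rightarrow> bool" where
  "computes_within M w v t \<longleftrightarrow> (\<exists>s \<le> t. let cfg = (tm_step M ^^ s) (tm_init M w) in
     fst cfg = states M \<and> tm_output cfg = map Input v)"

definition poly_time_computable_on ::
    "('a::finite) list set \<Rightarrow> ('a list \<Rightarrow> 'a list) \<Rightarrow> bool" where
  "poly_time_computable_on D f \<longleftrightarrow> (\<exists>(M :: 'a tm) (p :: nat poly). wf_tm M \<and>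
     (\<forall>w \<in> D. computes_within M w (f w) (poly p (length w))))"


section \<open>Decision problems and polynomial-time reductions\<close>

text \<open>
  A decision problem consists of instances, yes-instances among them, and an encoding
  relation. The encoding is a relation, and need not be defined for all instances, since
  instances contain real numbers and functions of a real variable, of which only some have
  a finite description.
\<close>

record ('i, 'a) decision_problem =
  instances :: "'i set"
  yes_instances :: "'i set"
  encodes :: "'a list \<Rightarrow> 'i \<Rightarrow> bool"

text \<open>
  A polynomial transformation in the sense of Garey and Johnson: it is applied to
  (encodings of) instances only, and has to produce (encodings of) instances. The encodings
  below are unambiguous: a word determines all data of the instance that its answer depends on.
\<close>

definition poly_time_reducible ::
    "('i, 'a::finite) decision_problem \<Rightarrow> ('j, 'a) decision_problem \<Rightarrow> bool" where
  "poly_time_reducible P Q \<longleftrightarrow> (\<exists>f.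
     poly_time_computable_on {w. \<exists>x \<in> instances P. encodes P w x} f \<and>
     (\<forall>x \<in> instances P. \<forall>w. encodes P w x \<longrightarrow>
        (\<exists>y \<in> instances Q. encodes Q (f w) y \<and>
           (x \<in> yes_instances P \<longleftrightarrow> y \<in> yes_instances Q))))"


section \<open>Encoding of numbers\<close>

datatype symbol = Bit bool | Minus | Slash | Comma | Semicolon | Infinite

instance symbol :: finite
proof
  have "(UNIV :: symbol set) \<subseteq> range Bit \<union> {Minus, Slash, Comma, Semicolon, Infinite}"
  proof
    fix x :: symbol
    show "x \<in> range Bit \<union> {Minus, Slash, Comma, Semicolon, Infinite}"
      by (cases x) auto
  qed
  then show "finite (UNIV :: symbol set)"
    by (rule finite_subset) simp
qed

type_synonym word = "symbol list"

text \<open>Binary, least significant bit first, without leading zeros (zero is the empty word).\<close>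

fun nat_word :: "nat \<Rightarrow> word" where
  "nat_word n = (if n = 0 then [] else Bit (odd n) # nat_word (n div 2))"

declare nat_word.simps [simp del]

definition int_word :: "int \<Rightarrow> word" where
  "int_word z = (if z < 0 then [Minus] else []) @ nat_word (nat \<bar>z\<bar>)"

text \<open>Numerator and denominator in lowest terms.\<close>

definition rat_word :: "rat \<Rightarrow> word" where
  "rat_word q = int_word (fst (quotient_of q)) @ [Slash] @ int_word (snd (quotient_of q))"


section \<open>Ordered unrelated machines scheduling\<close>

record sched =
  machines :: nat
  jobs :: nat
  time :: "nat \<Rightarrow> nat \<Rightarrow> real"
  bound :: real

definition sched_instance :: "sched \<Rightarrow> bool" where
  "sched_instance I \<longleftrightarrow> 1 \<le> machines I \<and>
     (\<forall>i \<in> {1..machines I}. \<forall>j \<in> {1..jobs I}. time I i j > 0) \<and>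
     (\<forall>i1 \<in> {1..machines I}. \<forall>i2 \<in> {1..machines I}. \<forall>j \<in> {1..jobs I}.
        i1 < i2 \<longrightarrow> time I i1 j \<ge> time I i2 j)"

definition sched_makespan :: "sched \<Rightarrow> (nat \<Rightarrow> nat) \<Rightarrow> real" where
  "sched_makespan I S =
     Max ((\<lambda>i. \<Sum>j \<in> {j \<in> {1..jobs I}. S j = i}. time I i j) ` {1..machines I})"

definition sched_yes :: "sched \<Rightarrow> bool" where
  "sched_yes I \<longleftrightarrow> (\<exists>S \<in> {1..jobs I} \<rightarrow> {1..machines I}. sched_makespan I S \<le> bound I)"

text \<open>The matrix is written job by job.\<close>

definition sched_encodes :: "word \<Rightarrow> sched \<Rightarrow> bool" where
  "sched_encodes w I \<longleftrightarrow> (\<exists>(T :: nat \<Rightarrow> nat \<Rightarrow> rat) (M :: rat).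
     (\<forall>i \<in> {1..machines I}. \<forall>j \<in> {1..jobs I}. time I i j = of_rat (T i j)) \<and>
     bound I = of_rat M \<and>
     w = nat_word (machines I) @ [Semicolon]
       @ concat (map (\<lambda>j. concat (map (\<lambda>i. rat_word (T i j) @ [Comma]) [1..<Suc (machines I)])
                          @ [Semicolon]) [1..<Suc (jobs I)])
       @ rat_word M)"

definition ordered_unrelated_scheduling :: "(sched, symbol) decision_problem" where
  "ordered_unrelated_scheduling =
     \<lparr>instances = {I. sched_instance I},
      yes_instances = {I. sched_instance I \<and> sched_yes I},
      encodes = sched_encodes\<rparr>"


section \<open>Joint cache partition and job assignment\<close>

record cache_inst =
  cores :: nat
  cache_size :: real
  cache_jobs :: nat
  run_time :: "nat \<Rightarrow> real \<Rightarrow> ereal"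
  cache_bound :: real

definition cache_instance :: "cache_inst \<Rightarrow> bool" where
  "cache_instance I \<longleftrightarrow> 1 \<le> cores I \<and> 0 \<le> cache_size I \<and>
     (\<forall>j \<in> {1..cache_jobs I}.
        (\<forall>x \<ge> 0. run_time I j x > 0) \<and>
        (\<forall>x y. 0 \<le> x \<and> x \<le> y \<longrightarrow> run_time I j y \<le> run_time I j x))"

definition cache_partition :: "cache_inst \<Rightarrow> (nat \<Rightarrow> real) \<Rightarrow> bool" where
  "cache_partition I p \<longleftrightarrow>
     (\<forall>i \<in> {1..cores I}. 0 \<le> p i) \<and> (\<Sum>i \<in> {1..cores I}. p i) \<le> cache_size I"

definition cache_makespan :: "cache_inst \<Rightarrow> (nat \<Rightarrow> real) \<Rightarrow> (nat \<Rightarrow> nat) \<Rightarrow> ereal" where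
  "cache_makespan I p S =
     Max ((\<lambda>i. \<Sum>j \<in> {j \<in> {1..cache_jobs I}. S j = i}. run_time I j (p i)) ` {1..cores I})"

definition cache_yes :: "cache_inst \<Rightarrow> bool" where
  "cache_yes I \<longleftrightarrow> (\<exists>p. cache_partition I p \<and>
     (\<exists>S \<in> {1..cache_jobs I} \<rightarrow> {1..cores I}. cache_makespan I p S \<le> ereal (cache_bound I)))"

text \<open>
  A step function is described by its breakpoints, starting with \<open>0\<close>, each paired with the
  value taken from there (inclusive) to the next breakpoint (exclusive); \<open>None\<close> stands for
  the value \<open>\<infinity>\<close>.
\<close>

type_synonym step_list = "(rat \<times> rat option) list"

definition step_value :: "rat option \<Rightarrow> ereal" where
  "step_value v = (case v of None \<Rightarrow> \<infinity> | Some q \<Rightarrow> ereal (of_rat q))"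

definition describes_step_function :: "step_list \<Rightarrow> (real \<Rightarrow> ereal) \<Rightarrow> bool" where
  "describes_step_function ps g \<longleftrightarrow>
     ps \<noteq> [] \<and> fst (hd ps) = 0 \<and> sorted_wrt (<) (map fst ps) \<and>
     (\<forall>k < length ps. \<forall>x.
        of_rat (fst (ps ! k)) \<le> x \<and>
        (Suc k < length ps \<longrightarrow> x < of_rat (fst (ps ! Suc k))) \<longrightarrow>
        g x = step_value (snd (ps ! k)))"

definition value_word :: "rat option \<Rightarrow> word" where
  "value_word v = (case v of None \<Rightarrow> [Infinite] | Some q \<Rightarrow> rat_word q)"

definition step_list_word :: "step_list \<Rightarrow> word" where
  "step_list_word ps =
     concat (map (\<lambda>(b, v). rat_word b @ [Comma] @ value_word v @ [Comma]) ps)"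

definition cache_encodes :: "word \<Rightarrow> cache_inst \<Rightarrow> bool" where
  "cache_encodes w I \<longleftrightarrow> (\<exists>(K :: rat) (M :: rat) (F :: nat \<Rightarrow> step_list).
     cache_size I = of_rat K \<and> cache_bound I = of_rat M \<and>
     (\<forall>j \<in> {1..cache_jobs I}. describes_step_function (F j) (run_time I j)) \<and>
     w = nat_word (cores I) @ [Semicolon] @ rat_word K @ [Semicolon]
       @ concat (map (\<lambda>j. step_list_word (F j) @ [Semicolon]) [1..<Suc (cache_jobs I)])
       @ rat_word M)"

definition joint_cache_partition_assignment :: "(cache_inst, symbol) decision_problem" where
  "joint_cache_partition_assignment =
     \<lparr>instances = {I. cache_instance I},
      yes_instances = {I. cache_instance I \<and> cache_yes I},
      encodes = cache_encodes\<rparr>"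

end

theory Submission
  imports Defs "HOL-Library.Stream"
begin

text \<open>
  Machine \<open>i\<close> becomes a core with \<open>2 ^ (i - 1)\<close> cache: job \<open>j\<close> takes time \<open>\<infinity>\<close> on less than one
  unit of cache and \<open>T i j\<close> between \<open>2 ^ (i - 1)\<close> and \<open>2 ^ i\<close>, and the total cache is the sum
  \<open>2 ^ c - 1\<close>. For each \<open>i\<close> there is a dummy job which needs cache \<open>2 ^ (i - 1)\<close> and then takes
  time \<open>D > M\<close>; the new bound is \<open>M + D\<close>, so that no core runs two dummies and the
  dummies enforce the intended partition. Without jobs there are no dummies and no cache: the
  matrix is then empty, and \<open>c\<close> dummies could be exponentially many.

  If the numerator of \<open>M = a / b\<close> has \<open>l\<close> bits, we take \<open>D = 2 ^ l\<close>. As binary words are written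
  with the least significant bit first, the word of the numerator \<open>a + 2 ^ l * b\<close> of \<open>M + D\<close> is
  the concatenation of those of \<open>a\<close> and \<open>b\<close>, so that the Turing machine only copies words and counts.
\<close>

section \<open>The Turing machine\<close>

type_synonym stape = "symbol cell stream \<times> symbol cell stream"

text \<open>
  Streams identify tapes that differ only in the blanks listed at their ends.
\<close>

definition blanks :: "'a cell stream" where
  "blanks = sconst Blank"

lemma blanks_simps [simp]: "shd blanks = Blank" "stl blanks = blanks" "Blank ## blanks = blanks"
  unfolding blanks_def by (simp, simp, metis siterate.code id_apply)

lemma head_of_Cons: "head_of (x # xs) = x"
  by (simp add: head_of_def)

lemma shd_shift_blanks: "shd (xs @- blanks) = head_of xs"
  by (cases xs) (auto simp: head_of_def)

lemma stl_shift_blanks: "stl (xs @- blanks) = tl xs @- blanks"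
  by (cases xs) auto

definition tape_view :: "'a tape \<Rightarrow> 'a cell stream \<times> 'a cell stream" where
  "tape_view t = (fst t @- blanks, snd t @- blanks)"

fun view_act :: "'a cell \<times> dir \<Rightarrow> 'a cell stream \<times> 'a cell stream \<Rightarrow> 'a cell stream \<times> 'a cell stream" where
  "view_act (x, Left) (l, r) = (stl l, shd l ## x ## stl r)"
| "view_act (x, Stay) (l, r) = (l, x ## stl r)"
| "view_act (x, Right) (l, r) = (x ## l, stl r)"

text \<open>Beyond the listed cells \<open>head_of\<close> yields \<open>Blank\<close> and
  \<open>tl\<close> stays empty, just as \<open>shd\<close> and \<open>stl\<close> act on
  \<open>blanks\<close>; hence leaving the listed part is no special case on streams.\<close>

lemma tape_view_act: "tape_view (act a t) = view_act a (tape_view t)"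
proof -
  obtain x d ls rs where "a = (x, d)" "t = (ls, rs)" by fastforce
  then show ?thesis
    by (cases d) (auto simp: tape_view_def shd_shift_blanks stl_shift_blanks head_of_Cons simp del: shift_simps)
qed

lemma shd_tape_view: "shd (snd (tape_view t)) = head_of (snd t)"
  by (simp add: tape_view_def shd_shift_blanks del: shift_simps)

section \<open>The program\<close>

abbreviation inputs :: "word \<Rightarrow> symbol cell list" where "inputs \<equiv> map Input"

abbreviation "cm \<equiv> Input Comma"
abbreviation "sc \<equiv> Input Semicolon"
abbreviation "sl \<equiv> Input Slash"
abbreviation "b0 \<equiv> Input (Bit False)"
abbreviation "b1 \<equiv> Input (Bit True)"

text \<open>
  States \<open>19, \<dots>, 35\<close> only print fixed words, reversed because the output is written from right
  to left; \<open>36\<close> halts.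
\<close>

definition printing :: "(symbol \<times> nat) list" where
  "printing =
    [(Semicolon, 20), (Comma, 21), (Bit True, 22), (Slash, 23), (Bit True, 10),
     (Comma, 25), (Bit True, 26), (Slash, 27), (Bit True, 12),
     (Comma, 29), (Infinite, 30), (Comma, 31), (Bit True, 32), (Slash, 9),
     (Semicolon, 34), (Bit True, 35), (Slash, 17)]"

type_synonym action = "symbol cell \<times> dir"

text \<open>
  The arguments \<open>i\<close>, \<open>r\<close>, \<open>b\<close>, \<open>w\<close> are the symbols on the input, counter, ruler and output tapes.
  States 0 to 4 scan the input to its end and, at the \<open>m\<close>-th comma of the first row, append a
  comma and \<open>m - 1\<close> zeros to the ruler, the counter providing \<open>m - 1\<close> in unary. The input is then
  read backwards: states 5 to 8 print the bound, 9 to 11 start a dummy job, 12 prints a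
  breakpoint from the ruler, 13 and 14 print the entries of a row, 15 rewinds the ruler,
  16 selects between a row and the header, 17 prints the cache size and 18 the number of cores.
  A dummy is finished like a row, so that 12 and 13 serve both.
\<close>

definition prog :: "nat \<Rightarrow> symbol cell \<Rightarrow> symbol cell \<Rightarrow> symbol cell \<Rightarrow> symbol cell \<Rightarrow>
    nat \<times> action \<times> action \<times> action \<times> action" where
  "prog q i r b w =
   (if q = 0 then (if i = sc then 1 else 0, (i, Right), (r, Stay), (b, Stay), (w, Stay))
    else if q = 1 then
      (if i = cm then (2, (i, Stay), (r, Left), (cm, Right), (w, Stay))
       else if i = sc \<or> i = Blank then (4, (i, Stay), (r, Stay), (b, Stay), (w, Stay))
       else (1, (i, Right), (r, Stay), (b, Stay), (w, Stay)))
    else if q = 2 then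
      (if r \<noteq> Blank then (2, (i, Stay), (r, Left), (b0, Right), (w, Stay))
       else (3, (i, Stay), (r, Right), (b, Stay), (w, Stay)))
    else if q = 3 then
      (if r \<noteq> Blank then (3, (i, Stay), (r, Right), (b, Stay), (w, Stay))
       else (1, (i, Right), (b0, Right), (b, Stay), (w, Stay)))
    else if q = 4 then
      (if i \<noteq> Blank then (4, (i, Right), (r, Stay), (b, Stay), (w, Stay))
       else (5, (i, Left), (r, Stay), (b, Stay), (w, Stay)))
    else if q = 5 then
      (if i \<noteq> sl then (5, (i, Left), (r, Stay), (b, Stay), (i, Left))
       else (6, (i, Right), (r, Stay), (b, Stay), (i, Left)))
    else if q = 6 then
      (if i \<noteq> Blank then (6, (i, Right), (r, Stay), (b, Stay), (w, Stay))
       else (7, (i, Left), (r, Stay), (b, Stay), (w, Stay)))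
    else if q = 7 then
      (if i \<noteq> sl then (7, (i, Left), (r, Stay), (b, Stay), (i, Left))
       else (8, (i, Left), (r, Stay), (b, Stay), (w, Stay)))
    else if q = 8 then
      (if i \<noteq> sc then (8, (i, Left), (r, Stay), (b, Stay), (i, Left))
       else (9, (i, Stay), (r, Stay), (b, Left), (w, Stay)))
    else if q = 9 then
      (if b = Blank then (15, (i, Stay), (r, Stay), (b, Right), (w, Stay))
       else (19, (i, Right), (r, Stay), (b, Stay), (w, Stay)))
    else if q = 10 then
      (if i \<noteq> sl then (10, (i, Right), (r, Stay), (b, Stay), (b0, Left))
       else (11, (i, Left), (r, Stay), (b, Stay), (w, Stay)))
    else if q = 11 then
      (if i \<noteq> sc then (11, (i, Left), (r, Stay), (b, Stay), (w, Stay))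
       else (24, (i, Stay), (r, Stay), (b, Stay), (w, Stay)))
    else if q = 12 then
      (if b = b0 then (12, (i, Stay), (r, Stay), (b, Left), (b0, Left))
       else (13, (i, Stay), (r, Stay), (b, Left), (w, Stay)))
    else if q = 13 then
      (if i = cm then (14, (i, Left), (r, Stay), (b, Stay), (i, Left))
       else (28, (i, Stay), (r, Stay), (b, Stay), (w, Stay)))
    else if q = 14 then
      (if i \<noteq> cm \<and> i \<noteq> sc then (14, (i, Left), (r, Stay), (b, Stay), (i, Left))
       else (24, (i, Stay), (r, Stay), (b, Stay), (w, Stay)))
    else if q = 15 then
      (if b \<noteq> Blank then (15, (i, Stay), (r, Stay), (b, Right), (w, Stay))
       else (16, (i, Left), (r, Stay), (b, Left), (w, Stay)))
    else if q = 16 then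
      (if i = cm then (13, (i, Stay), (r, Stay), (b, Stay), (sc, Left))
       else (33, (i, Stay), (r, Stay), (b, Stay), (w, Stay)))
    else if q = 17 then
      (if b = cm then (17, (i, Stay), (r, Stay), (b, Left), (b1, Left))
       else if b \<noteq> Blank then (17, (i, Stay), (r, Stay), (b, Left), (w, Stay))
       else (18, (i, Stay), (r, Stay), (b, Stay), (sc, Left)))
    else if q = 18 then
      (if i \<noteq> Blank then (18, (i, Left), (r, Stay), (b, Stay), (i, Left))
       else (36, (i, Stay), (r, Stay), (b, Stay), (w, Right)))
    else (snd (printing ! (q - 19)),
      (i, Stay), (r, Stay), (b, Stay), (Input (fst (printing ! (q - 19))), Left)))"

definition reduction_tm :: "symbol tm" where
  "reduction_tm = \<lparr>tapes = 4, states = 36, work_symbols = 0,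
     delta = (\<lambda>q xs. case prog q (xs ! 0) (xs ! 1) (xs ! 2) (xs ! 3) of
        (q', ai, ar, ab, aw) \<Rightarrow> (q', [ai, ar, ab, aw]))\<rparr>"

lemma reduction_tm_simps [simp]:
  "tapes reduction_tm = 4" "states reduction_tm = 36" "work_symbols reduction_tm = 0"
  by (simp_all add: reduction_tm_def)

text \<open>Every written symbol is one of the four symbols read or an input symbol, so no work
  symbols arise.\<close>

lemma wf_reduction_tm: "wf_tm reduction_tm"
proof -
  define ok where "ok S p \<longleftrightarrow> (case p of (q', ai, ar, ab, aw) \<Rightarrow>
      q' \<le> 36 \<and> fst ` {ai, ar, ab, aw} \<subseteq> S)" for S :: "symbol cell set" and p :: "nat \<times> action \<times> action \<times> action \<times> action"
  \<comment> \<open>As an introduction rule this descends through the nested conditionals of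
    \<open>prog\<close>, leaving one goal per leaf.\<close>
  have ok_if: "(c \<Longrightarrow> ok S p) \<Longrightarrow> (\<not> c \<Longrightarrow> ok S p') \<Longrightarrow> ok S (if c then p else p')" for c S p p'
    by simp
  have *: "ok ({i, r, b, w} \<union> range Input) (prog q i r b w)" if "q < 36" for q i r b w
    unfolding prog_def
  proof (intro ok_if)
    \<comment> \<open>Only the last leaf needs an argument: \<open>q\<close> is then between 19 and
      35, so \<open>q - 19\<close> indexes one of the 17 entries of \<open>printing\<close>.\<close>
    assume "q \<noteq> 0" "q \<noteq> 1" "q \<noteq> 2" "q \<noteq> 3" "q \<noteq> 4" "q \<noteq> 5" "q \<noteq> 6" "q \<noteq> 7" "q \<noteq> 8" "q \<noteq> 9"
      "q \<noteq> 10" "q \<noteq> 11" "q \<noteq> 12" "q \<noteq> 13" "q \<noteq> 14" "q \<noteq> 15" "q \<noteq> 16" "q \<noteq> 17" "q \<noteq> 18"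
    then have "q - 19 < length printing" using that by (simp add: printing_def)
    then have "printing ! (q - 19) \<in> set printing" by (rule nth_mem)
    then have "snd (printing ! (q - 19)) \<le> 36" by (auto simp: printing_def)
    then show "ok ({i, r, b, w} \<union> range Input) (snd (printing ! (q - 19)),
      (i, Stay), (r, Stay), (b, Stay), (Input (fst (printing ! (q - 19))), Left))"
      by (simp add: ok_def)
  qed (simp_all add: ok_def)
  have **: "set xs \<subseteq> tape_alphabet reduction_tm \<Longrightarrow> length xs = 4 \<Longrightarrow>
      {xs ! 0, xs ! 1, xs ! 2, xs ! 3} \<union> range Input \<subseteq> tape_alphabet reduction_tm" for xs
    by (auto simp: tape_alphabet_def numeral_eq_Suc length_Suc_conv)
  show ?thesis
    unfolding wf_tm_def
  proof (intro conjI allI impI)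
    fix q and xs :: "symbol cell list"
    assume q: "q < states reduction_tm"
      and xs: "length xs = tapes reduction_tm \<and> set xs \<subseteq> tape_alphabet reduction_tm"
    obtain q' ai ar ab aw where p: "prog q (xs ! 0) (xs ! 1) (xs ! 2) (xs ! 3) = (q', ai, ar, ab, aw)"
      by (metis prod_cases5)
    then have d: "delta reduction_tm q xs = (q', [ai, ar, ab, aw])"
      by (simp add: reduction_tm_def)
    have "ok ({xs ! 0, xs ! 1, xs ! 2, xs ! 3} \<union> range Input) (q', ai, ar, ab, aw)"
      using *[of q "xs ! 0" "xs ! 1" "xs ! 2" "xs ! 3"] q unfolding p by simp
    then have q': "q' \<le> 36"
      and a: "fst ` {ai, ar, ab, aw} \<subseteq> {xs ! 0, xs ! 1, xs ! 2, xs ! 3} \<union> range Input"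
      unfolding ok_def by blast+
    have "fst ` {ai, ar, ab, aw} \<subseteq> tape_alphabet reduction_tm"
      using **[of xs] xs by (intro subset_trans[OF a]) simp
    then show "fst ` set (snd (delta reduction_tm q xs)) \<subseteq> tape_alphabet reduction_tm"
      unfolding d by simp
    show "fst (delta reduction_tm q xs) \<le> states reduction_tm"
      "length (snd (delta reduction_tm q xs)) = tapes reduction_tm"
      using q' by (simp_all add: d)
  qed simp
qed

section \<open>Runs on stream configurations and their relation to the machine\<close>

type_synonym conf = "nat \<times> stape \<times> stape \<times> stape \<times> stape"

definition step :: "conf \<Rightarrow> conf" where
  "step c = (case c of (q, I, R, B, W) \<Rightarrow>
     (case prog q (shd (snd I)) (shd (snd R)) (shd (snd B)) (shd (snd W)) of
        (q', ai, ar, ab, aw) \<Rightarrow> (q', view_act ai I, view_act ar R, view_act ab B, view_act aw W)))"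

definition views :: "symbol config \<Rightarrow> conf \<Rightarrow> bool" where
  "views c v \<longleftrightarrow> (case v of (q, I, R, B, W) \<Rightarrow>
     fst c = q \<and> map tape_view (snd c) = [I, R, B, W])"

text \<open>The bound on the state puts \<open>tm_step\<close> into its non-halting branch;
  \<open>step\<close> itself knows no halting state.\<close>

lemma views_step:
  assumes "views c v" "fst v < 36"
  shows "views (tm_step reduction_tm c) (step v)"
proof -
  obtain q I R B W where v: "v = (q, I, R, B, W)" by (metis prod_cases5)
  from assms(1) obtain ti tr tb tw where c: "c = (q, [ti, tr, tb, tw])"
    and t: "I = tape_view ti" "R = tape_view tr" "B = tape_view tb" "W = tape_view tw"
    by (cases c) (auto simp: views_def v)
  obtain q' ai ar ab aw where p: "prog q (head_of (snd ti)) (head_of (snd tr)) (head_of (snd tb))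
      (head_of (snd tw)) = (q', ai, ar, ab, aw)"
    by (metis prod_cases5)
  have "delta reduction_tm q (map (head_of \<circ> snd) [ti, tr, tb, tw]) = (q', [ai, ar, ab, aw])"
    by (simp add: reduction_tm_def p)
  then show ?thesis using assms(2)
    by (simp add: views_def v c t tm_step_def step_def shd_tape_view p tape_view_act)
qed

text \<open>The number \<open>n\<close> is only an upper bound, so time estimates can be loosened.
  The clause on earlier configurations is there because \<open>step\<close> would not stop at state
  36.\<close>

definition reaches :: "nat \<Rightarrow> conf \<Rightarrow> conf \<Rightarrow> bool" where
  "reaches n c c' \<longleftrightarrow> (\<exists>s\<le>n. (step ^^ s) c = c' \<and> (\<forall>u<s. fst ((step ^^ u) c) < 36))"

lemma reaches_refl [simp]: "reaches n c c"
  unfolding reaches_def by (intro exI[of _ 0]) auto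

lemma reaches_step:
  assumes "reaches n (step c) c'" "fst c < 36"
  shows "reaches (Suc n) c c'"
proof -
  obtain s where s: "s \<le> n" "(step ^^ s) (step c) = c'" "\<forall>u<s. fst ((step ^^ u) (step c)) < 36"
    using assms(1) by (auto simp: reaches_def)
  have "fst ((step ^^ u) c) < 36" if "u < Suc s" for u
    using that s(3) assms(2) by (cases u) (auto simp: funpow_swap1)
  then show ?thesis
    unfolding reaches_def using s by (intro exI[of _ "Suc s"]) (auto simp: funpow_swap1)
qed

text \<open>Time bounds add up, so a calculation over consecutive phases also computes their total
  running time.\<close>

lemma reaches_trans [trans]:
  assumes "reaches m a b" "reaches n b c"
  shows "reaches (m + n) a c"
proof -
  obtain s where s: "s \<le> m" "(step ^^ s) a = b" "\<forall>u<s. fst ((step ^^ u) a) < 36"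
    using assms(1) by (auto simp: reaches_def)
  obtain t where t: "t \<le> n" "(step ^^ t) b = c" "\<forall>u<t. fst ((step ^^ u) b) < 36"
    using assms(2) by (auto simp: reaches_def)
  have *: "(step ^^ (u + s)) a = (step ^^ u) b" for u by (simp add: funpow_add s(2))
  have "fst ((step ^^ u) a) < 36" if "u < t + s" for u
    using that s(3) t(3) *[of "u - s"] by (cases "u < s") auto
  moreover have "(step ^^ (t + s)) a = c" using * t(2) by simp
  ultimately show ?thesis
    unfolding reaches_def using s(1) t(1) by (intro exI[of _ "t + s"]) auto
qed

lemma reaches_mono: "reaches m a b \<Longrightarrow> m \<le> n \<Longrightarrow> reaches n a b"
  unfolding reaches_def using le_trans by blast

text \<open>Closes the calculations: it brings the tapes into the intended form and relaxes the
  accumulated time bound.\<close>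

lemma reaches_weaken:
  "reaches m a b \<Longrightarrow> a = a' \<Longrightarrow> b = b' \<Longrightarrow> m \<le> n \<Longrightarrow> reaches n a' b'"
  using reaches_mono by simp

lemma reaches_views:
  assumes "reaches n v v'" "views c v"
  shows "\<exists>s\<le>n. views ((tm_step reduction_tm ^^ s) c) v'"
proof -
  obtain s where s: "s \<le> n" "(step ^^ s) v = v'" "\<forall>u<s. fst ((step ^^ u) v) < 36"
    using assms(1) by (auto simp: reaches_def)
  have "u \<le> s \<Longrightarrow> views ((tm_step reduction_tm ^^ u) c) ((step ^^ u) v)" for u
    by (induction u) (use assms(2) s(3) in \<open>auto intro!: views_step\<close>)
  then show ?thesis using s by blast
qed

text \<open>A tape whose left part, including the cell under the head, is \<open>s\<close>.\<close>

definition leftward :: "'a stream \<Rightarrow> 'a stream \<Rightarrow> 'a stream \<times> 'a stream" where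
  "leftward s r = (stl s, shd s ## r)"

lemma leftward_SCons [simp]: "leftward (x ## s) r = (s, x ## r)"
  by (simp add: leftward_def)

lemma shd_snd_leftward [simp]: "shd (snd (leftward s r)) = shd s"
  by (simp add: leftward_def)

text \<open>The output tape while it is filled from right to left: the head waits on the blank cell
  just before the text, so printing a symbol prepends it to \<open>s\<close>.\<close>

definition written :: "'a cell stream \<Rightarrow> 'a cell stream \<times> 'a cell stream" where
  "written s = (blanks, Blank ## s)"

lemma view_act_unchanged [simp]: "shd (snd t) = x \<Longrightarrow> view_act (x, Stay) t = t"
  by (cases t) auto

text \<open>Used in place of the defining equation, so that left moves keep configurations in the
  form \<open>leftward\<close>.\<close>

lemma view_act_Left: "view_act (x, Left) (l, r) = leftward l (x ## stl r)"
  by (simp add: leftward_def)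

declare view_act.simps(1) [simp del]

lemma view_act_written [simp]: "view_act (x, Left) (written s) = written (x ## s)"
  by (simp add: written_def view_act_Left leftward_def)

lemma shd_written [simp]: "shd (snd (written s)) = Blank"
  by (simp add: written_def)

lemma view_act_written_Stay [simp]: "view_act (Blank, Stay) (written s) = written s"
  by (simp add: written_def)

text \<open>A generic loop: \<open>T\<close> bundles the other three tapes, and the symbols passed
  pile up reversed on the left.\<close>

lemma scan_right:
  assumes "\<And>x l r. x \<in> set xs \<Longrightarrow> step (q, (l, Input x ## r), T) = (q, (Input x ## l, r), T)" "q < 36"
  shows "reaches (length xs) (q, (l, inputs xs @- r), T) (q, (rev (inputs xs) @- l, r), T)"
  using assms(1)
proof (induction xs arbitrary: l)
  case (Cons x xs)
  then show ?case using assms(2) by (auto intro!: reaches_step)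
qed simp

lemma scan_left:
  assumes "\<And>x l r. x \<in> set xs \<Longrightarrow>
      step (q, (l, Input x ## r), T) = (q, leftward l (Input x ## r), T)" "q < 36"
  shows "reaches (length xs) (q, leftward (rev (inputs xs) @- l) r, T) (q, leftward l (inputs xs @- r), T)"
  using assms(1)
proof (induction xs arbitrary: r rule: rev_induct)
  case (snoc x xs)
  then show ?case using assms(2) by (auto intro!: reaches_step)
qed simp

text \<open>The input is read from its end and the output is written towards the left, so the copy
  has the original order.\<close>

lemma copy_left:
  assumes "\<And>x l r s. x \<in> set xs \<Longrightarrow> step (q, (l, Input x ## r), R, B, written s) =
      (q, leftward l (Input x ## r), R, B, written (Input x ## s))"
    and "q < 36"
  shows "reaches (length xs) (q, leftward (rev (inputs xs) @- l) r, R, B, written s)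
    (q, leftward l (inputs xs @- r), R, B, written (inputs xs @- s))"
  using assms(1)
proof (induction xs arbitrary: r s rule: rev_induct)
  case (snoc x xs)
  then show ?case using assms(2) by (auto intro!: reaches_step)
qed simp

lemmas step_simps = step_def prog_def view_act_Left

lemma printing_nth [simp]:
  "printing ! 0 = (Semicolon, 20)" "printing ! 1 = (Comma, 21)" "printing ! Suc 0 = (Comma, 21)"
  "printing ! 2 = (Bit True, 22)" "printing ! 3 = (Slash, 23)" "printing ! 4 = (Bit True, 10)"
  "printing ! 5 = (Comma, 25)" "printing ! 6 = (Bit True, 26)" "printing ! 7 = (Slash, 27)"
  "printing ! 8 = (Bit True, 12)" "printing ! 9 = (Comma, 29)" "printing ! 10 = (Infinite, 30)"
  "printing ! 11 = (Comma, 31)" "printing ! 12 = (Bit True, 32)" "printing ! 13 = (Slash, 9)"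
  "printing ! 14 = (Semicolon, 34)" "printing ! 15 = (Bit True, 35)" "printing ! 16 = (Slash, 17)"
  by (simp_all add: printing_def)

lemma reaches_numeral:
  assumes "reaches (pred_numeral k) (step c) c'" "fst c < 36"
  shows "reaches (numeral k) c c'"
  using reaches_step[OF assms] by (simp add: numeral_eq_Suc)

lemma reaches_one:
  assumes "step c = c'" "fst c < 36"
  shows "reaches (Suc 0) c c'"
  using assms by (intro reaches_step) auto

text \<open>From left to right, the four pieces are: the end \<open>1/1,;\<close> of a dummy job,
  the end \<open>1/1,\<close> of a breakpoint, the entry with breakpoint 0 and infinite value (zero
  has an empty numerator), and the end \<open>/1;\<close> of the cache size.\<close>

lemma print_steps:
  "reaches 5 (19, I, R, B, written s) (10, I, R, B, written (b1 ## sl ## b1 ## cm ## sc ## s))"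
  "reaches 4 (24, I, R, B, written s) (12, I, R, B, written (b1 ## sl ## b1 ## cm ## s))"
  "reaches 5 (28, I, R, B, written s) (9, I, R, B, written (sl ## b1 ## cm ## Input Infinite ## cm ## s))"
  "reaches 3 (33, I, R, B, written s) (17, I, R, B, written (sl ## b1 ## sc ## s))"
  by (auto intro!: reaches_numeral reaches_step simp: step_simps)

section \<open>Forward pass: counting machines and building the ruler\<close>

definition row_word :: "word list \<Rightarrow> word" where
  "row_word vs = concat (map (\<lambda>v. v @ [Comma]) vs)"

lemma row_word_simps [simp]:
  "row_word [] = []" "row_word (v # vs) = v @ Comma # row_word vs"
  "row_word (us @ vs) = row_word us @ row_word vs"
  by (simp_all add: row_word_def)

text \<open>In reading order, that is, from the right end of the tape.\<close>

fun ruler :: "nat \<Rightarrow> symbol cell list" where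
  "ruler 0 = []"
| "ruler (Suc m) = replicate m b0 @ cm # ruler m"

lemma replicate_shift_comm: "replicate m x @- x ## s = x ## replicate m x @- s"
  by (induction m arbitrary: s) auto

text \<open>After the comma is written, one walk over the \<open>m\<close> counter marks appends a
  zero for each, and the walk back ends by adding a mark. Two walks and three single steps give
  \<open>2 * m + 3\<close>.\<close>

lemma extend_ruler:
  "reaches (2 * m + 3) (1, (l, cm ## r), (replicate m b0 @- blanks, blanks), (ruler m @- blanks, blanks), W)
    (1, (cm ## l, r), (replicate (Suc m) b0 @- blanks, blanks), (ruler (Suc m) @- blanks, blanks), W)"
proof -
  have 1: "reaches 1 (1, (l, cm ## r), (replicate m b0 @- blanks, blanks), (b, blanks), W)
     (2, (l, cm ## r), leftward (replicate m b0 @- blanks) blanks, (cm ## b, blanks), W)" for b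
    by (auto intro!: reaches_one simp: step_simps leftward_def)
  have 2: "reaches n (2, I, leftward (replicate n b0 @- blanks) s, (b, blanks), W)
     (2, I, leftward blanks (replicate n b0 @- s), (replicate n b0 @- b, blanks), W)" for n I s b
  proof (induction n arbitrary: s b)
    case (Suc n)
    show ?case
      by (rule reaches_step) (use Suc[of "b0 ## s" "b0 ## b"] in \<open>simp_all add: step_simps replicate_shift_comm\<close>)
  qed simp
  have 3: "reaches 1 (2, I, leftward blanks s, B, W) (3, I, (blanks, s), B, W)" for I s B
    by (auto intro!: reaches_one simp: step_simps leftward_def)
  have 4: "reaches n (3, I, (s, replicate n b0 @- blanks), B, W) (3, I, (replicate n b0 @- s, blanks), B, W)" for n I s B
  proof (induction n arbitrary: s)
    case (Suc n)
    show ?case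
      by (rule reaches_step) (use Suc[of "b0 ## s"] in \<open>simp_all add: step_simps replicate_shift_comm\<close>)
  qed simp
  have 5: "reaches 1 (3, (l, cm ## r), (s, blanks), B, W) (1, (cm ## l, r), (b0 ## s, blanks), B, W)" for s B
    by (auto intro!: reaches_one simp: step_simps leftward_def)
  note 1
  also note 2
  also note 3
  also note 4
  also note 5
  finally show ?thesis
    by (rule reaches_weaken) (simp_all add: replicate_shift_comm)
qed

text \<open>The uniform \<open>k\<close> replaces the growing counter value in the cost of each
  comma.\<close>

lemma scan_row:
  assumes "set (concat vs) \<inter> {Comma, Semicolon} = {}" "m + length vs \<le> k"
  shows "reaches (length (row_word vs) + length vs * (2 * k + 3))
    (1, (l, inputs (row_word vs) @- r), (replicate m b0 @- blanks, blanks), (ruler m @- blanks, blanks), W)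
    (1, (rev (inputs (row_word vs)) @- l, r), (replicate (m + length vs) b0 @- blanks, blanks),
      (ruler (m + length vs) @- blanks, blanks), W)"
  using assms
proof (induction vs arbitrary: m l)
  case (Cons v vs)
  let ?R = "\<lambda>m. (replicate m b0 @- blanks, blanks)" and ?B = "\<lambda>m. (ruler m @- blanks, blanks)"
  have "reaches (length v) (1, (l, inputs v @- cm ## inputs (row_word vs) @- r), ?R m, ?B m, W)
      (1, (rev (inputs v) @- l, cm ## inputs (row_word vs) @- r), ?R m, ?B m, W)"
    by (rule scan_right) (use Cons.prems in \<open>auto simp: step_simps\<close>)
  also have "reaches (2 * m + 3) \<dots> (1, (cm ## rev (inputs v) @- l, inputs (row_word vs) @- r),
      ?R (Suc m), ?B (Suc m), W)"
    by (rule extend_ruler)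
  also have "reaches (length (row_word vs) + length vs * (2 * k + 3)) \<dots>
      (1, (rev (inputs (row_word vs)) @- cm ## rev (inputs v) @- l, r),
      ?R (Suc m + length vs), ?B (Suc m + length vs), W)"
    using Cons.prems by (intro Cons.IH) auto
  finally show ?case
    by (rule reaches_weaken) (use Cons.prems in simp_all)
qed simp

text \<open>The split covers both shapes of the input. With jobs, \<open>vs\<close> is the first
  row, \<open>u\<close> is empty and \<open>t\<close> is the rest; without jobs, \<open>vs\<close>
  and \<open>t\<close> are empty and \<open>u\<close> is the bound, so the ruler stays
  empty.\<close>

lemma forward_pass:
  assumes w: "w = C @ Semicolon # row_word vs @ u @ t"
    and "Semicolon \<notin> set C" "set (concat vs) \<inter> {Comma, Semicolon} = {}"
    and "set u \<inter> {Comma, Semicolon} = {}" "t = [] \<or> hd t = Semicolon"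
  shows "reaches (length w + length vs * (2 * length vs + 3) + 2)
    (0, (blanks, inputs w @- blanks), (blanks, blanks), (blanks, blanks), written blanks)
    (5, leftward (rev (inputs w) @- blanks) blanks, (replicate (length vs) b0 @- blanks, blanks),
      (ruler (length vs) @- blanks, blanks), written blanks)"
proof -
  let ?E = "(blanks, blanks) :: stape" and ?W = "written blanks :: stape"
  let ?R = "(replicate (length vs) b0 @- blanks, blanks)" and ?B = "(ruler (length vs) @- blanks, blanks)"
  let ?l1 = "sc ## rev (inputs C) @- blanks"
  let ?l2 = "rev (inputs (row_word vs)) @- ?l1"
  have "reaches (length C) (0, (blanks, inputs C @- sc ## inputs (row_word vs @ u @ t) @- blanks), ?E, ?E, ?W)
      (0, (rev (inputs C) @- blanks, sc ## inputs (row_word vs @ u @ t) @- blanks), ?E, ?E, ?W)"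
    by (rule scan_right) (use assms(2) in \<open>auto simp: step_simps\<close>)
  also have "reaches 1 \<dots> (1, (?l1, inputs (row_word vs) @- inputs (u @ t) @- blanks), ?E, ?E, ?W)"
    by (simp add: reaches_one step_simps)
  also have "reaches (length (row_word vs) + length vs * (2 * length vs + 3)) \<dots>
      (1, (?l2, inputs u @- inputs t @- blanks), ?R, ?B, ?W)"
    using scan_row[OF assms(3), of 0 "length vs"] by simp
  also have "reaches (length u) \<dots> (1, (rev (inputs u) @- ?l2, inputs t @- blanks), ?R, ?B, ?W)"
    by (rule scan_right) (use assms(4) in \<open>auto simp: step_simps\<close>)
  also have "reaches 1 \<dots> (4, (rev (inputs u) @- ?l2, inputs t @- blanks), ?R, ?B, ?W)"
    using assms(5) by (cases t) (simp_all add: reaches_one step_simps)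
  also have "reaches (length t) \<dots> (4, (rev (inputs t) @- rev (inputs u) @- ?l2, blanks), ?R, ?B, ?W)"
    by (rule scan_right) (simp_all add: step_simps)
  also have "reaches 1 \<dots> (5, leftward (rev (inputs t) @- rev (inputs u) @- ?l2) blanks, ?R, ?B, ?W)"
    by (simp add: reaches_one step_simps)
  finally show ?thesis
    by (rule reaches_weaken) (simp_all add: w)
qed

section \<open>Backward pass: printing the output from right to left\<close>

lemma leftward_blanks [simp]: "leftward blanks s = (blanks, Blank ## s)"
  by (simp add: leftward_def)

text \<open>The bound \<open>P / Q\<close> becomes \<open>P Q / Q\<close>: after the first copy of
  \<open>Q\<close> the head returns to the right end and copies \<open>Q\<close> again, then
  \<open>P\<close>. This takes three passes over \<open>Q\<close>. The last step also puts the ruler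
  head on its last cell.\<close>

lemma bound_phase:
  assumes "Slash \<notin> set P" "Slash \<notin> set Q" "Semicolon \<notin> set P"
  shows "reaches (length P + 3 * length Q + 6)
    (5, leftward (rev (inputs (P @ Slash # Q)) @- sc ## l) blanks, R, (b, blanks), written s)
    (9, (l, sc ## inputs (P @ Slash # Q) @- blanks), R, leftward b blanks,
      written (inputs (P @ Q @ Slash # Q) @- s))"
proof -
  let ?l = "rev (inputs P) @- sc ## l" and ?B = "(b, blanks)"
  have "reaches (length Q) (5, leftward (rev (inputs Q) @- sl ## ?l) blanks, R, ?B, written s)
      (5, leftward (sl ## ?l) (inputs Q @- blanks), R, ?B, written (inputs Q @- s))"
    by (rule copy_left) (use assms in \<open>auto simp: step_simps\<close>)
  also have "reaches 1 \<dots> (6, (sl ## ?l, inputs Q @- blanks), R, ?B, written (sl ## inputs Q @- s))"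
    by (simp add: reaches_one step_simps)
  also have "reaches (length Q) \<dots> (6, (rev (inputs Q) @- sl ## ?l, blanks), R, ?B, written (sl ## inputs Q @- s))"
    by (rule scan_right) (simp_all add: step_simps)
  also have "reaches 1 \<dots> (7, leftward (rev (inputs Q) @- sl ## ?l) blanks, R, ?B, written (sl ## inputs Q @- s))"
    by (simp add: reaches_one step_simps)
  also have "reaches (length Q) \<dots>
      (7, leftward (sl ## ?l) (inputs Q @- blanks), R, ?B, written (inputs Q @- sl ## inputs Q @- s))"
    by (rule copy_left) (use assms in \<open>auto simp: step_simps\<close>)
  also have "reaches 1 \<dots>
      (8, leftward ?l (sl ## inputs Q @- blanks), R, ?B, written (inputs Q @- sl ## inputs Q @- s))"
    by (simp add: reaches_one step_simps)
  also have "reaches (length P) \<dots> (8, leftward (sc ## l) (inputs P @- sl ## inputs Q @- blanks), R, ?B,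
      written (inputs P @- inputs Q @- sl ## inputs Q @- s))"
    by (rule copy_left) (use assms in \<open>auto simp: step_simps\<close>)
  also have "reaches 1 \<dots> (9, (l, sc ## inputs P @- sl ## inputs Q @- blanks), R, leftward b blanks,
      written (inputs P @- inputs Q @- sl ## inputs Q @- s))"
    by (simp add: reaches_one step_simps)
  finally show ?thesis
    by (rule reaches_weaken) simp_all
qed

lemma shd_replicate_shift: "shd (replicate m x @- y ## s) = (if m = 0 then y else x)"
  by (cases m) simp_all

text \<open>The zeros of a ruler segment are the low bits of a power of two; its leading one has
  been printed before, to their right.\<close>

lemma ruler_zeros:
  "reaches (m + 1) (12, I, R, leftward (replicate m b0 @- cm ## l) b, written s)
    (13, I, R, leftward l (cm ## replicate m b0 @- b), written (replicate m b0 @- s))"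
proof (induction m arbitrary: b s)
  case 0
  show ?case by (simp add: reaches_one step_simps)
next
  case (Suc m)
  have "reaches 1 (12, I, R, leftward (b0 ## replicate m b0 @- cm ## l) b, written s)
      (12, I, R, leftward (replicate m b0 @- cm ## l) (b0 ## b), written (b0 ## s))"
    by (simp add: reaches_one step_simps)
  also note Suc.IH
  finally show ?case
    by (rule reaches_weaken) (simp_all add: replicate_shift_comm)
qed

text \<open>
  The value \<open>2 ^ length P\<close> of the dummies is printed by running over the numerator of the bound
  on the input tape.
\<close>

lemma zeros_right:
  assumes "Slash \<notin> set P"
  shows "reaches (length P) (10, (l, inputs P @- r), R, B, written s)
    (10, (rev (inputs P) @- l, r), R, B, written (replicate (length P) b0 @- s))"
  using assms
proof (induction P arbitrary: l s)
  case (Cons x P)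
  have "reaches 1 (10, (l, Input x ## inputs P @- r), R, B, written s)
      (10, (Input x ## l, inputs P @- r), R, B, written (b0 ## s))"
    using Cons.prems by (auto simp: reaches_one step_simps)
  also have "reaches (length P) \<dots> (10, (rev (inputs P) @- Input x ## l, r), R, B,
      written (replicate (length P) b0 @- b0 ## s))"
    using Cons by simp
  finally show ?case
    by (rule reaches_weaken) (simp_all add: replicate_shift_comm)
qed simp

text \<open>The word of the rational \<open>2 ^ i\<close>, followed by the separator.\<close>

definition breakpoint_word :: "nat \<Rightarrow> word" where
  "breakpoint_word i = replicate i (Bit False) @ [Bit True, Slash, Bit True, Comma]"

definition dummy_word :: "nat \<Rightarrow> nat \<Rightarrow> word" where
  "dummy_word p i = [Slash, Bit True, Comma, Infinite, Comma] @ breakpoint_word i @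
     replicate p (Bit False) @ [Bit True, Slash, Bit True, Comma, Semicolon]"

text \<open>The ruler yields its longest segment first and printing goes leftwards, so the dummies
  appear in increasing order. Each dummy costs two passes over \<open>P\<close>: one to print zeros,
  one to return.\<close>

lemma dummies_phase:
  fixes P m
  defines "p \<equiv> length P"
  assumes "Slash \<notin> set P" "Semicolon \<notin> set P" "m \<le> k"
  shows "reaches (m * (2 * p + k + 20))
    (9, (l, sc ## inputs P @- sl ## r), R, leftward (ruler m @- blanks) b, written s)
    (9, (l, sc ## inputs P @- sl ## r), R, leftward blanks (rev (ruler m) @- b),
      written (inputs (concat (map (dummy_word p) [0..<m])) @- s))"
  using assms(4)
proof (induction m arbitrary: b s)
  case (Suc m)
  let ?I = "(l, sc ## inputs P @- sl ## r)" and ?B = "leftward (ruler (Suc m) @- blanks) b"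
  let ?B' = "leftward (ruler m @- blanks) (cm ## replicate m b0 @- b)"
  let ?s1 = "b1 ## sl ## b1 ## cm ## sc ## s"
  let ?s2 = "replicate p b0 @- ?s1"
  let ?s3 = "replicate m b0 @- b1 ## sl ## b1 ## cm ## ?s2"
  let ?s4 = "sl ## b1 ## cm ## Input Infinite ## cm ## ?s3"
  have dummy: "inputs (dummy_word p m) @- s = ?s4"
    by (simp add: dummy_word_def breakpoint_word_def)
  have "reaches 1 (9, ?I, R, ?B, written s) (19, (sc ## l, inputs P @- sl ## r), R, ?B, written s)"
    by (simp add: reaches_one step_simps shd_replicate_shift)
  also have "reaches 5 \<dots> (10, (sc ## l, inputs P @- sl ## r), R, ?B, written ?s1)"
    by (rule print_steps)
  also have "reaches p \<dots> (10, (rev (inputs P) @- sc ## l, sl ## r), R, ?B, written ?s2)"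
    unfolding p_def by (rule zeros_right) fact
  also have "reaches 1 \<dots> (11, leftward (rev (inputs P) @- sc ## l) (sl ## r), R, ?B, written ?s2)"
    by (simp add: reaches_one step_simps)
  also have "reaches p \<dots> (11, leftward (sc ## l) (inputs P @- sl ## r), R, ?B, written ?s2)"
    unfolding p_def by (rule scan_left) (use assms in \<open>auto simp: step_simps\<close>)
  also have "reaches 1 \<dots> (24, ?I, R, ?B, written ?s2)"
    by (simp add: reaches_one step_simps)
  also have "reaches 4 \<dots> (12, ?I, R, ?B, written (b1 ## sl ## b1 ## cm ## ?s2))"
    by (rule print_steps)
  also have "reaches (m + 1) \<dots> (13, ?I, R, ?B', written ?s3)"
    using ruler_zeros by simp
  also have "reaches 1 \<dots> (28, ?I, R, ?B', written ?s3)"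
    by (simp add: reaches_one step_simps)
  also have "reaches 5 \<dots> (9, ?I, R, ?B', written ?s4)"
    by (rule print_steps)
  also have "reaches (m * (2 * p + k + 20)) \<dots> (9, ?I, R,
      leftward blanks (rev (ruler m) @- cm ## replicate m b0 @- b),
      written (inputs (concat (map (dummy_word p) [0..<m])) @- ?s4))"
    using Suc by simp
  finally show ?case
    by (rule reaches_weaken) (use Suc.prems in \<open>simp_all add: dummy\<close>)
qed simp

text \<open>Besides restoring the ruler head, the last step moves the input head left past the
  separator \<open>y\<close>, where state 16 can inspect what precedes it.\<close>

lemma rewind_phase:
  assumes "Blank \<notin> set xs"
  shows "reaches (length xs + 2)
    (9, (l, y ## r), R, leftward blanks (xs @- blanks), W)
    (16, leftward l (y ## r), R, leftward (rev xs @- blanks) blanks, W)"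
proof -
  have 1: "reaches (length xs) (15, (l, y ## r), R, (b, xs @- blanks), W)
      (15, (l, y ## r), R, (rev xs @- b, blanks), W)" for b
    using assms
  proof (induction xs arbitrary: b)
    case (Cons x xs)
    then have "reaches (length xs) (step (15, (l, y ## r), R, (b, (x # xs) @- blanks), W))
        (15, (l, y ## r), R, (rev xs @- x ## b, blanks), W)"
      by (auto simp: step_simps)
    from reaches_step[OF this] show ?case by simp
  qed simp
  have "reaches 1 (9, (l, y ## r), R, leftward blanks (xs @- blanks), W)
      (15, (l, y ## r), R, (blanks, xs @- blanks), W)"
    by (simp add: reaches_one step_simps)
  also note 1
  also have "reaches 1 (15, (l, y ## r), R, (rev xs @- blanks, blanks), W)
      (16, leftward l (y ## r), R, leftward (rev xs @- blanks) blanks, W)"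
    by (simp add: reaches_one step_simps)
  finally show ?thesis
    by (rule reaches_weaken) simp_all
qed

lemma Blank_notin_ruler: "Blank \<notin> set (ruler m)"
  by (induction m) auto

lemma length_ruler: "length (ruler m) \<le> m * m"
  by (induction m) auto

definition entries_word :: "word list \<Rightarrow> word" where
  "entries_word vs = concat (map (\<lambda>i. breakpoint_word i @ vs ! i @ [Comma]) [0..<length vs])"

lemma entries_word_snoc:
  "entries_word (vs @ [v]) = entries_word vs @ breakpoint_word (length vs) @ v @ [Comma]"
proof -
  have "map (\<lambda>i. breakpoint_word i @ (vs @ [v]) ! i @ [Comma]) [0..<length vs] =
      map (\<lambda>i. breakpoint_word i @ vs ! i @ [Comma]) [0..<length vs]"
    by (rule map_cong) (auto simp: nth_append)
  then show ?thesis by (simp add: entries_word_def del: map_eq_conv)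
qed

definition job_word :: "word list \<Rightarrow> word" where
  "job_word vs = [Slash, Bit True, Comma, Infinite, Comma] @ entries_word vs @ [Semicolon]"

text \<open>Row and ruler are consumed together from the right: the last entry meets the longest
  segment, so the entry at index \<open>i\<close> receives breakpoint \<open>2 ^ i\<close>.\<close>

lemma entries_phase:
  assumes "set (concat vs) \<inter> {Comma, Semicolon} = {}" "length vs \<le> k"
  shows "reaches (length (row_word vs) + length vs * (k + 6))
    (13, leftward (rev (inputs (row_word vs)) @- sc ## l) r, R,
      leftward (ruler (length vs) @- blanks) b, written s)
    (13, (l, sc ## inputs (row_word vs) @- r), R,
      leftward blanks (rev (ruler (length vs)) @- b), written (inputs (entries_word vs) @- s))"
  using assms
proof (induction vs arbitrary: r b s rule: rev_induct)
  case Nil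
  show ?case by (simp add: entries_word_def)
next
  case (snoc v vs)
  let ?m = "length vs" and ?l = "rev (inputs (row_word vs)) @- sc ## l"
  let ?B = "leftward (ruler (Suc ?m) @- blanks) b"
  let ?B' = "leftward (ruler ?m @- blanks) (cm ## replicate ?m b0 @- b)"
  let ?I = "leftward ?l (inputs v @- cm ## r)"
  let ?s1 = "inputs v @- cm ## s"
  let ?s2 = "b1 ## sl ## b1 ## cm ## ?s1"
  have "reaches 1 (13, leftward (cm ## rev (inputs v) @- ?l) r, R, ?B, written s)
      (14, leftward (rev (inputs v) @- ?l) (cm ## r), R, ?B, written (cm ## s))"
    by (simp add: reaches_one step_simps)
  also have "reaches (length v) \<dots> (14, ?I, R, ?B, written ?s1)"
    by (rule copy_left) (use snoc.prems in \<open>auto simp: step_simps\<close>)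
  \<comment> \<open>The copy of an entry stops at the comma of the previous entry, or at the
    semicolon if it is the first of its row.\<close>
  also have "reaches 1 \<dots> (24, ?I, R, ?B, written ?s1)"
    by (cases vs rule: rev_cases) (simp_all add: reaches_one step_simps)
  also have "reaches 4 \<dots> (12, ?I, R, ?B, written ?s2)"
    by (rule print_steps)
  also have "reaches (?m + 1) \<dots> (13, ?I, R, ?B', written (replicate ?m b0 @- ?s2))"
    using ruler_zeros by simp
  also have "reaches (length (row_word vs) + length vs * (k + 6)) \<dots>
      (13, (l, sc ## inputs (row_word vs) @- inputs v @- cm ## r), R,
        leftward blanks (rev (ruler ?m) @- cm ## replicate ?m b0 @- b),
        written (inputs (entries_word vs) @- replicate ?m b0 @- ?s2))"
    using snoc by simp
  finally show ?case
    by (rule reaches_weaken) (use snoc.prems in \<open>simp_all add: entries_word_snoc breakpoint_word_def\<close>)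
qed

text \<open>A nonempty row ends in a comma, by which state 16 recognizes it. The ruler runs out
  together with the row, so state 9 proceeds to rewinding and not to another dummy.\<close>

lemma job_phase:
  fixes vs defines "k \<equiv> length vs"
  assumes "set (concat vs) \<inter> {Comma, Semicolon} = {}" "vs \<noteq> []"
  shows "reaches (length (row_word vs) + k * (2 * k + 6) + 9)
    (16, leftward (rev (inputs (row_word vs)) @- sc ## l) r, R,
      leftward (ruler k @- blanks) blanks, written s)
    (16, leftward l (sc ## inputs (row_word vs) @- r), R,
      leftward (ruler k @- blanks) blanks, written (inputs (job_word vs) @- s))"
proof -
  let ?I = "leftward (rev (inputs (row_word vs)) @- sc ## l) r"
  let ?I' = "(l, sc ## inputs (row_word vs) @- r)"
  let ?B = "leftward (ruler k @- blanks) blanks" and ?B' = "leftward blanks (rev (ruler k) @- blanks)"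
  let ?s = "inputs (entries_word vs) @- sc ## s"
  let ?s' = "sl ## b1 ## cm ## Input Infinite ## cm ## ?s"
  have "reaches 1 (16, ?I, R, ?B, written s) (13, ?I, R, ?B, written (sc ## s))"
    using assms(3) by (cases vs rule: rev_cases) (simp_all add: reaches_one step_simps)
  also have "reaches (length (row_word vs) + k * (k + 6)) \<dots> (13, ?I', R, ?B', written ?s)"
    unfolding k_def by (rule entries_phase) (use assms in auto)
  also have "reaches 1 \<dots> (28, ?I', R, ?B', written ?s)"
    by (simp add: reaches_one step_simps)
  also have "reaches 5 \<dots> (9, ?I', R, ?B', written ?s')"
    by (rule print_steps)
  also have "reaches (length (rev (ruler k)) + 2) \<dots>
      (16, leftward l (sc ## inputs (row_word vs) @- r), R,
        leftward (rev (rev (ruler k)) @- blanks) blanks, written ?s')"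
    by (rule rewind_phase) (simp add: Blank_notin_ruler)
  finally show ?thesis
    by (rule reaches_weaken) (use length_ruler[of k] in \<open>simp_all add: job_word_def algebra_simps\<close>)
qed

text \<open>The separator precedes each row, which suits reading backwards: a row is finished when
  its semicolon is met.\<close>

definition jobs_word :: "word list list \<Rightarrow> word" where
  "jobs_word vss = concat (map (\<lambda>vs. Semicolon # row_word vs) vss)"

lemma jobs_phase:
  assumes "\<forall>vs \<in> set vss. set (concat vs) \<inter> {Comma, Semicolon} = {} \<and> vs \<noteq> [] \<and> length vs = k"
  shows "reaches (length (jobs_word vss) + length vss * (k * (2 * k + 6) + 9))
    (16, leftward (rev (inputs (jobs_word vss)) @- l) r, R,
      leftward (ruler k @- blanks) blanks, written s)
    (16, leftward l (inputs (jobs_word vss) @- r), R,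
      leftward (ruler k @- blanks) blanks, written (inputs (concat (map job_word vss)) @- s))"
  using assms
proof (induction vss arbitrary: r s rule: rev_induct)
  case (snoc vs vss)
  let ?l = "rev (inputs (jobs_word vss)) @- l"
  have "reaches (length (row_word vs) + k * (2 * k + 6) + 9)
    (16, leftward (rev (inputs (row_word vs)) @- sc ## ?l) r, R,
      leftward (ruler k @- blanks) blanks, written s)
    (16, leftward ?l (sc ## inputs (row_word vs) @- r), R,
      leftward (ruler k @- blanks) blanks, written (inputs (job_word vs) @- s))"
    using job_phase[of vs] snoc.prems by simp
  also have "reaches (length (jobs_word vss) + length vss * (k * (2 * k + 6) + 9)) \<dots>
      (16, leftward l (inputs (jobs_word vss) @- sc ## inputs (row_word vs) @- r), R,
        leftward (ruler k @- blanks) blanks,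
        written (inputs (concat (map job_word vss)) @- inputs (job_word vs) @- s))"
    using snoc by simp
  finally show ?case
    by (rule reaches_weaken) (simp_all add: jobs_word_def)
qed (simp add: jobs_word_def)

text \<open>The ruler holds \<open>m\<close> commas; turned into ones, they form the binary word of
  \<open>2 ^ m - 1\<close>, the numerator of the cache size.\<close>

lemma ones_phase:
  "reaches (length (ruler m)) (17, I, R, leftward (ruler m @- blanks) b, written s)
    (17, I, R, leftward blanks (rev (ruler m) @- b), written (replicate m b1 @- s))"
proof (induction m arbitrary: b s)
  case (Suc m)
  have 1: "reaches n (17, I, R, leftward (replicate n b0 @- l) b, written s)
      (17, I, R, leftward l (replicate n b0 @- b), written s)" for n l
  proof (induction n arbitrary: b)
    case (Suc n)
    have "reaches 1 (17, I, R, leftward (b0 ## replicate n b0 @- l) b, written s)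
        (17, I, R, leftward (replicate n b0 @- l) (b0 ## b), written s)"
      by (simp add: reaches_one step_simps)
    also note Suc
    finally show ?case
      by (rule reaches_weaken) (simp_all add: replicate_shift_comm)
  qed simp
  let ?b = "cm ## replicate m b0 @- b"
  note 1
  also have "reaches 1 (17, I, R, leftward (cm ## ruler m @- blanks) (replicate m b0 @- b), written s)
      (17, I, R, leftward (ruler m @- blanks) ?b, written (b1 ## s))"
    by (simp add: reaches_one step_simps)
  also note Suc.IH
  finally show ?case
    by (rule reaches_weaken) (simp_all add: replicate_shift_comm)
qed simp

lemma header_phase:
  assumes "Comma \<notin> set C"
  shows "reaches (length C + length (ruler k) + 6)
    (16, leftward (rev (inputs C) @- blanks) r, R, leftward (ruler k @- blanks) blanks, written s)
    (36, leftward blanks (inputs C @- r), R, leftward blanks (rev (ruler k) @- blanks), (blanks,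
      inputs (C @ [Semicolon] @ replicate k (Bit True) @ [Slash, Bit True, Semicolon]) @- s))"
proof -
  let ?I = "leftward (rev (inputs C) @- blanks) r" and ?B = "leftward (ruler k @- blanks) blanks"
  let ?B' = "leftward blanks (rev (ruler k) @- blanks)"
  let ?s = "replicate k b1 @- sl ## b1 ## sc ## s"
  have "reaches 1 (16, ?I, R, ?B, written s) (33, ?I, R, ?B, written s)"
    using assms by (cases C rule: rev_cases) (auto simp: reaches_one step_simps)
  also have "reaches 3 \<dots> (17, ?I, R, ?B, written (sl ## b1 ## sc ## s))"
    by (rule print_steps)
  also have "reaches (length (ruler k)) \<dots> (17, ?I, R, ?B', written ?s)"
    by (rule ones_phase)
  also have "reaches 1 \<dots> (18, ?I, R, ?B', written (sc ## ?s))"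
    by (simp add: reaches_one step_simps)
  also have "reaches (length C) \<dots>
      (18, leftward blanks (inputs C @- r), R, ?B', written (inputs C @- sc ## ?s))"
    by (rule copy_left) (simp_all add: step_simps)
  \<comment> \<open>The head moves from the waiting blank onto the first symbol, where the output is
    read off.\<close>
  also have "reaches 1 \<dots> (36, leftward blanks (inputs C @- r), R, ?B', (blanks, inputs C @- sc ## ?s))"
    by (simp add: reaches_one step_simps written_def)
  finally show ?thesis
    by (rule reaches_weaken) simp_all
qed

text \<open>
  \<open>C\<close> is the number of machines, \<open>vss\<close> lists the rows of the matrix, one for each job, and
  \<open>P/Q\<close> is the bound.
\<close>

definition sched_word :: "word \<Rightarrow> word list list \<Rightarrow> word \<Rightarrow> word \<Rightarrow> word" where
  "sched_word C vss P Q = C @ jobs_word vss @ Semicolon # P @ Slash # Q"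

definition cache_word :: "word \<Rightarrow> word list list \<Rightarrow> word \<Rightarrow> word \<Rightarrow> nat \<Rightarrow> word" where
  "cache_word C vss P Q k = C @ [Semicolon] @ replicate k (Bit True) @ [Slash, Bit True, Semicolon] @
     concat (map job_word vss) @ concat (map (dummy_word (length P)) [0..<k]) @ P @ Q @ Slash # Q"

text \<open>Chains all phases. The cubic term stems from at most \<open>n\<close> rows, each costing
  a time quadratic in \<open>k\<close>. Without rows no ruler is built, hence \<open>k = 0\<close>
  in that case.\<close>

lemma reaches_output:
  assumes "set C \<inter> {Comma, Semicolon} = {}" "set P \<inter> {Comma, Semicolon, Slash} = {}"
    and "set Q \<inter> {Comma, Semicolon, Slash} = {}"
    and vss: "\<forall>vs \<in> set vss. set (concat vs) \<inter> {Comma, Semicolon} = {} \<and> vs \<noteq> [] \<and> length vs = k"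
    and k: "vss = [] \<Longrightarrow> k = 0"
  defines "n \<equiv> length (sched_word C vss P Q)"
  shows "\<exists>I R B. reaches (100 * (n + 1) ^ 3)
    (0, (blanks, inputs (sched_word C vss P Q) @- blanks), (blanks, blanks), (blanks, blanks), written blanks)
    (36, I, R, B, (blanks, inputs (cache_word C vss P Q k) @- blanks))"
proof -
  let ?w = "sched_word C vss P Q"
  obtain vs u t where w: "?w = C @ Semicolon # row_word vs @ u @ t" and "length vs = k"
    and "set (concat vs) \<inter> {Comma, Semicolon} = {}" "set u \<inter> {Comma, Semicolon} = {}"
    and "t = [] \<or> hd t = Semicolon"
  proof (cases vss)
    case Nil
    show ?thesis
      by (rule that[of "[]" "P @ Slash # Q" "[]"])
        (use assms Nil in \<open>auto simp: sched_word_def jobs_word_def\<close>)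
  next
    case (Cons vs vss')
    show ?thesis
      by (rule that[of vs "[]" "jobs_word vss' @ Semicolon # P @ Slash # Q"])
        (use vss Cons in \<open>auto simp: sched_word_def jobs_word_def neq_Nil_conv split: list.splits\<close>,
         (cases vss'; simp))
  qed
  let ?I0 = "(blanks, inputs ?w @- blanks)" and ?E = "(blanks, blanks)"
  let ?R = "(replicate k b0 @- blanks, blanks)"
  let ?B = "leftward (ruler k @- blanks) blanks" and ?B' = "leftward blanks (rev (ruler k) @- blanks)"
  let ?l = "rev (inputs (jobs_word vss)) @- rev (inputs C) @- blanks"
  let ?r = "inputs P @- sl ## inputs Q @- blanks"
  let ?r' = "inputs (jobs_word vss) @- sc ## ?r"
  let ?s1 = "inputs (P @ Q @ Slash # Q) @- blanks"
  let ?s2 = "inputs (concat (map (dummy_word (length P)) [0..<k])) @- ?s1"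
  let ?s3 = "inputs (concat (map job_word vss)) @- ?s2"
  have "reaches (length ?w + k * (2 * k + 3) + 2) (0, ?I0, ?E, ?E, written blanks)
      (5, leftward (rev (inputs ?w) @- blanks) blanks, ?R, (ruler k @- blanks, blanks), written blanks)"
    using forward_pass[OF w] assms \<open>length vs = k\<close>
      \<open>set (concat vs) \<inter> {Comma, Semicolon} = {}\<close> \<open>set u \<inter> {Comma, Semicolon} = {}\<close>
      \<open>t = [] \<or> hd t = Semicolon\<close> by simp
  also have "rev (inputs ?w) @- blanks = rev (inputs (P @ Slash # Q)) @- sc ## ?l"
    by (simp add: sched_word_def)
  also have "reaches (length P + 3 * length Q + 6)
      (5, leftward (rev (inputs (P @ Slash # Q)) @- sc ## ?l) blanks, ?R, (ruler k @- blanks, blanks), written blanks)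
      (9, (?l, sc ## inputs (P @ Slash # Q) @- blanks), ?R, ?B, written ?s1)"
    by (rule bound_phase) (use assms in auto)
  also have "inputs (P @ Slash # Q) @- blanks = ?r" by simp
  also have "reaches (k * (2 * length P + k + 20)) (9, (?l, sc ## ?r), ?R, ?B, written ?s1)
      (9, (?l, sc ## ?r), ?R, ?B', written ?s2)"
    by (rule dummies_phase) (use assms in auto)
  also have "reaches (length (rev (ruler k)) + 2) \<dots>
      (16, leftward ?l (sc ## ?r), ?R, leftward (rev (rev (ruler k)) @- blanks) blanks, written ?s2)"
    by (rule rewind_phase) (simp add: Blank_notin_ruler)
  also have "rev (rev (ruler k)) = ruler k" by simp
  also have "reaches (length (jobs_word vss) + length vss * (k * (2 * k + 6) + 9))
      (16, leftward ?l (sc ## ?r), ?R, ?B, written ?s2)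
      (16, leftward (rev (inputs C) @- blanks) ?r', ?R, ?B, written ?s3)"
    by (rule jobs_phase) (rule vss)
  also have "reaches (length C + length (ruler k) + 6) \<dots>
      (36, leftward blanks (inputs C @- ?r'), ?R, ?B',
       (blanks, inputs (C @ [Semicolon] @ replicate k (Bit True) @ [Slash, Bit True, Semicolon]) @- ?s3))"
    by (rule header_phase) (use assms in auto)
  finally have "reaches (100 * (n + 1) ^ 3) (0, ?I0, ?E, ?E, written blanks)
      (36, leftward blanks (inputs C @- ?r'), ?R, ?B',
       (blanks, inputs (cache_word C vss P Q k) @- blanks))"
  proof (rule reaches_weaken)
    have "length vs \<le> length (row_word vs)" by (induction vs) auto
    then have "k \<le> n" using w \<open>length vs = k\<close> by (simp add: n_def)
    have len: "length P \<le> n" "length Q \<le> n" "length C \<le> n" "length (jobs_word vss) \<le> n" "length ?w = n"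
      by (simp_all add: n_def sched_word_def)
    have "length vss \<le> length (jobs_word vss)" by (induction vss) (auto simp: jobs_word_def)
    then have "length vss \<le> n" using len by simp
    have "k * k \<le> n * n" using \<open>k \<le> n\<close> by (simp add: mult_le_mono)
    then have r: "length (ruler k) \<le> n * n" using length_ruler[of k] by linarith
    have a: "k * (2 * k + 3) \<le> n * (2 * n + 3)" "k * (2 * length P + k + 20) \<le> n * (2 * n + n + 20)"
      "length vss * (k * (2 * k + 6) + 9) \<le> n * (n * (2 * n + 6) + 9)"
      using \<open>k \<le> n\<close> len \<open>length vss \<le> n\<close> by (intro mult_le_mono add_le_mono; simp)+
    show "length ?w + k * (2 * k + 3) + 2 + (length P + 3 * length Q + 6) +
        k * (2 * length P + k + 20) + (length (rev (ruler k)) + 2) +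
        (length (jobs_word vss) + length vss * (k * (2 * k + 6) + 9)) +
        (length C + length (ruler k) + 6) \<le> 100 * (n + 1) ^ 3"
    proof -
      \<comment> \<open>Expanded into the same monomials, the two sides are compared by linear
        arithmetic.\<close>
      have "100 * (n + 1) ^ 3 = 100 * (n * (n * n)) + 300 * (n * n) + 300 * n + 100"
        by (simp add: power3_eq_cube algebra_simps)
      moreover have "n * (2 * n + 3) = 2 * (n * n) + 3 * n" "n * (2 * n + n + 20) = 3 * (n * n) + 20 * n"
        "n * (n * (2 * n + 6) + 9) = 2 * (n * (n * n)) + 6 * (n * n) + 9 * n"
        by (simp_all add: algebra_simps)
      ultimately show ?thesis using a r len by simp
    qed
  qed (simp_all add: cache_word_def)
  then show ?thesis by blast
qed

text \<open>Streams determine a tape only up to trailing blanks, and the output is cut at the first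
  blank.\<close>

lemma takeWhile_blank:
  assumes "xs @- blanks = inputs v @- blanks"
  shows "takeWhile (\<lambda>x. x \<noteq> Blank) xs = inputs v"
  using assms
proof (induction v arbitrary: xs)
  case Nil
  then show ?case by (cases xs) (simp_all, metis blanks_simps(1) stream.sel(1))
next
  case (Cons a v)
  then show ?case by (cases xs) (auto, metis blanks_simps(1) cell.distinct(1) stream.sel(1))
qed

lemma reduction_tm_computes:
  assumes "set C \<inter> {Comma, Semicolon} = {}" "set P \<inter> {Comma, Semicolon, Slash} = {}"
    and "set Q \<inter> {Comma, Semicolon, Slash} = {}"
    and "\<forall>vs \<in> set vss. set (concat vs) \<inter> {Comma, Semicolon} = {} \<and> vs \<noteq> [] \<and> length vs = k"
    and "vss = [] \<Longrightarrow> k = 0"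
  shows "computes_within reduction_tm (sched_word C vss P Q) (cache_word C vss P Q k)
    (100 * (length (sched_word C vss P Q) + 1) ^ 3)"
proof -
  let ?w = "sched_word C vss P Q"
  have *: "views (tm_init reduction_tm ?w)
      (0, (blanks, inputs ?w @- blanks), (blanks, blanks), (blanks, blanks), written blanks)"
    by (simp add: views_def tm_init_def tape_view_def written_def numeral_eq_Suc)
  obtain s I R B where s: "s \<le> 100 * (length ?w + 1) ^ 3"
      "views ((tm_step reduction_tm ^^ s) (tm_init reduction_tm ?w))
        (36, I, R, B, (blanks, inputs (cache_word C vss P Q k) @- blanks))"
    using reaches_views[OF _ *] reaches_output[of C P Q vss k] assms by metis
  let ?c = "(tm_step reduction_tm ^^ s) (tm_init reduction_tm ?w)"
  obtain t1 t2 t3 t4 where t: "snd ?c = [t1, t2, t3, t4]"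
      "tape_view t4 = (blanks, inputs (cache_word C vss P Q k) @- blanks)"
    using s(2) by (auto simp: views_def)
  have "tm_output ?c = inputs (cache_word C vss P Q k)"
    using t by (auto simp: tm_output_def tape_view_def intro!: takeWhile_blank)
  moreover have "fst ?c = 36" using s(2) by (simp add: views_def)
  ultimately show ?thesis using s(1) by (auto simp: computes_within_def Let_def)
qed

text \<open>A halted configuration never changes, so all halting times show the same output. This
  allows the reduction to be defined as a function on words.\<close>

lemma computes_within_unique:
  assumes "computes_within M w v t" "computes_within M w v' t'"
  shows "v = v'"
proof -
  have "tm_step M c = c" if "fst c = states M" for c
    using that by (cases c) (simp add: tm_step_def)
  then have halted: "(tm_step M ^^ (n + s)) c = (tm_step M ^^ s) c"
    if "fst ((tm_step M ^^ s) c) = states M" for n s c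
    using that by (induction n) simp_all
  have *: "v = v'" if "s \<le> s'" "fst ((tm_step M ^^ s) (tm_init M w)) = states M"
    "tm_output ((tm_step M ^^ s) (tm_init M w)) = map Input v"
    "tm_output ((tm_step M ^^ s') (tm_init M w)) = map Input v'" for s s' and v v' :: "'a list"
    using halted[of s "tm_init M w" "s' - s"] that by (auto simp: inj_map_eq_map inj_def)
  show ?thesis
    using assms unfolding computes_within_def Let_def by (metis * nle_le)
qed

section \<open>Correctness of the reduction\<close>

text \<open>The machine that a core with cache \<open>x\<close> imitates; the value 0 means
  none.\<close>

definition level :: "nat \<Rightarrow> real \<Rightarrow> nat" where
  "level c x = card {i \<in> {..<c}. 2 ^ i \<le> x}"

text \<open>The top level has no upper limit, hence the conditional bound on
  \<open>x\<close>.\<close>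

lemma level_eq:
  assumes "i < c" "2 ^ i \<le> x" "Suc i < c \<Longrightarrow> x < 2 ^ Suc i"
  shows "level c x = Suc i"
proof -
  have "{j \<in> {..<c}. 2 ^ j \<le> x} = {..i}"
  proof (intro set_eqI iffI)
    fix j assume j: "j \<in> {j \<in> {..<c}. 2 ^ j \<le> x}"
    show "j \<in> {..i}"
    proof (rule ccontr)
      assume "j \<notin> {..i}"
      then have "Suc i \<le> j" by simp
      moreover from this have "(2::real) ^ Suc i \<le> 2 ^ j" by (intro power_increasing) auto
      ultimately show False using assms(3) j by auto
    qed
  next
    fix j assume "j \<in> {..i}"
    moreover from this have "(2::real) ^ j \<le> 2 ^ i" by (intro power_increasing) auto
    ultimately show "j \<in> {j \<in> {..<c}. 2 ^ j \<le> x}"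
      using assms(1) order_trans[OF _ assms(2), of "2 ^ j"] by simp
  qed
  then show ?thesis by (simp add: level_def)
qed

lemma level_eq_0:
  assumes "x < 1"
  shows "level c x = 0"
proof -
  have "\<not> 2 ^ i \<le> x" for i :: nat
    using one_le_power[of "2::real" i] assms by linarith
  then show ?thesis by (simp add: level_def)
qed

lemma level_mono: "x \<le> y \<Longrightarrow> level c x \<le> level c y"
  unfolding level_def by (intro card_mono) auto

lemma level_le: "level c x \<le> c"
  unfolding level_def using card_mono[of "{..<c}" "{i \<in> {..<c}. 2 ^ i \<le> x}"] by auto

section \<open>The constructed cache instance\<close>

definition dummies :: "sched \<Rightarrow> nat" where
  "dummies I = (if jobs I = 0 then 0 else machines I)"

text \<open>The bound \<open>B\<close> is a separate parameter: it is the old bound plus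
  \<open>D\<close> only if the old bound is nonnegative, and otherwise some negative number.\<close>

definition reduced :: "sched \<Rightarrow> real \<Rightarrow> real \<Rightarrow> cache_inst" where
  "reduced I D B = \<lparr>cores = machines I, cache_size = 2 ^ dummies I - 1,
     cache_jobs = jobs I + dummies I,
     run_time = (\<lambda>j x.
       if j \<le> jobs I then
         (if level (machines I) x = 0 then \<infinity> else ereal (time I (level (machines I) x) j))
       else if x < 2 ^ (j - Suc (jobs I)) then \<infinity> else ereal D),
     cache_bound = B\<rparr>"

lemma reduced_simps [simp]:
  "cores (reduced I D B) = machines I" "cache_size (reduced I D B) = 2 ^ dummies I - 1"
  "cache_jobs (reduced I D B) = jobs I + dummies I" "cache_bound (reduced I D B) = B"
  by (simp_all add: reduced_def)

lemma run_time_job: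
  "j \<le> jobs I \<Longrightarrow> run_time (reduced I D B) j x =
    (if level (machines I) x = 0 then \<infinity> else ereal (time I (level (machines I) x) j))"
  by (simp add: reduced_def)

lemma run_time_dummy:
  "run_time (reduced I D B) (Suc (jobs I + i)) x = (if x < 2 ^ i then \<infinity> else ereal D)"
  by (simp add: reduced_def)

text \<open>The order of the machines enters here: more cache raises the level, and a higher machine
  is no slower.\<close>

lemma cache_instance_reduced:
  assumes "sched_instance I" "D > 0"
  shows "cache_instance (reduced I D B)"
  unfolding cache_instance_def
proof (intro conjI ballI allI impI)
  have I: "1 \<le> machines I"
    and pos: "\<And>i j. i \<in> {1..machines I} \<Longrightarrow> j \<in> {1..jobs I} \<Longrightarrow> time I i j > 0"
    and less: "\<And>i i' j. i \<in> {1..machines I} \<Longrightarrow> i' \<in> {1..machines I} \<Longrightarrow> j \<in> {1..jobs I} \<Longrightarrow>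
      i < i' \<Longrightarrow> time I i' j \<le> time I i j"
    using assms(1) unfolding sched_instance_def by blast+
  have le: "time I i' j \<le> time I i j"
    if "i \<in> {1..machines I}" "i' \<in> {1..machines I}" "j \<in> {1..jobs I}" "i \<le> i'" for i i' j
    using that less[of i i' j] by (cases "i = i'") auto
  show "1 \<le> cores (reduced I D B)" "0 \<le> cache_size (reduced I D B)" using I by auto
  fix j assume j: "j \<in> {1..cache_jobs (reduced I D B)}"
  show "0 < run_time (reduced I D B) j x" for x
    using pos[of "level (machines I) x" j] j assms(2) level_le[of "machines I" x]
    by (simp add: reduced_def Suc_le_eq)
  fix x y :: real assume "0 \<le> x \<and> x \<le> y"
  then show "run_time (reduced I D B) j y \<le> run_time (reduced I D B) j x"
    using le[of "level (machines I) x" "level (machines I) y" j] level_mono[of x y "machines I"] j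
      level_le[of "machines I" x] level_le[of "machines I" y]
    by (simp add: reduced_def Suc_le_eq)
qed

section \<open>Equivalence of the yes-instances\<close>

lemma sched_makespan_le:
  assumes "1 \<le> machines I"
  shows "sched_makespan I S \<le> M \<longleftrightarrow>
    (\<forall>i \<in> {1..machines I}. (\<Sum>j \<in> {j \<in> {1..jobs I}. S j = i}. time I i j) \<le> M)"
  unfolding sched_makespan_def using assms by (subst Max_le_iff) auto

lemma cache_makespan_le:
  assumes "1 \<le> cores I"
  shows "cache_makespan I p S \<le> M \<longleftrightarrow>
    (\<forall>i \<in> {1..cores I}. (\<Sum>j \<in> {j \<in> {1..cache_jobs I}. S j = i}. run_time I j (p i)) \<le> M)"
  unfolding cache_makespan_def using assms by (subst Max_le_iff) auto

lemma sum_powers: "(\<Sum>i<n. (2::real) ^ i) = 2 ^ n - 1"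
  by (induction n) auto

text \<open>Core \<open>i\<close> imitates machine \<open>i\<close> and runs one dummy in addition,
  which uses up the extra \<open>D\<close> of the bound.\<close>

lemma cache_yes_reduced:
  assumes I: "sched_instance I" "sched_yes I" and B: "bound I \<ge> 0 \<Longrightarrow> B = bound I + D" and D: "D > 0"
  shows "cache_yes (reduced I D B)"
proof -
  let ?c = "machines I" and ?n = "jobs I"
  have c: "1 \<le> ?c" and pos: "\<And>i j. i \<in> {1..?c} \<Longrightarrow> j \<in> {1..?n} \<Longrightarrow> time I i j > 0"
    using I(1) by (auto simp: sched_instance_def)
  obtain S where S: "S \<in> {1..?n} \<rightarrow> {1..?c}"
    and load: "\<And>i. i \<in> {1..?c} \<Longrightarrow> (\<Sum>j \<in> {j \<in> {1..?n}. S j = i}. time I i j) \<le> bound I"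
    using I(2) c by (auto simp: sched_yes_def sched_makespan_le)
  \<comment> \<open>Loads are nonnegative, so the old bound is too and \<open>B\<close> has its
    intended value.\<close>
  have "0 \<le> (\<Sum>j \<in> {j \<in> {1..?n}. S j = 1}. time I 1 j)"
    using pos c by (intro sum_nonneg) (auto intro: less_imp_le)
  then have B: "B = bound I + D" and "bound I \<ge> 0" using load[of 1] c B by auto
  \<comment> \<open>Without jobs the total cache is 0, so the partition has to vanish.\<close>
  define p :: "nat \<Rightarrow> real" where "p i = (if ?n = 0 then 0 else 2 ^ (i - 1))" for i
  define S' where "S' j = (if j \<le> ?n then S j else j - ?n)" for j
  have "(\<Sum>i \<in> {1..?c}. p i) = 2 ^ dummies I - 1"
  proof (cases "?n = 0")
    case False
    have "(\<Sum>i \<in> {1..?c}. p i) = (\<Sum>i<?c. 2 ^ i)"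
      by (rule sum.reindex_bij_witness[of _ Suc "\<lambda>i. i - 1"]) (use False in \<open>auto simp: p_def\<close>)
    then show ?thesis using False by (simp add: dummies_def sum_powers)
  qed (simp add: dummies_def p_def)
  then have "cache_partition (reduced I D B) p"
    by (simp add: cache_partition_def p_def)
  moreover have "S' \<in> {1..?n + dummies I} \<rightarrow> {1..?c}"
    using S by (auto simp: S'_def dummies_def Pi_iff)
  moreover have "(\<Sum>j \<in> {j \<in> {1..?n + dummies I}. S' j = i}. run_time (reduced I D B) j (p i)) \<le> ereal B"
    if i: "i \<in> {1..?c}" for i
  proof (cases "?n = 0")
    case True
    then show ?thesis using B D \<open>bound I \<ge> 0\<close> by (simp add: dummies_def)
  next
    case False
    have set: "{j \<in> {1..?n + dummies I}. S' j = i} = insert (?n + i) {j \<in> {1..?n}. S j = i}"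
      using False i by (auto simp: S'_def dummies_def)
    have lev: "level ?c (p i) = i"
      using i False level_eq[of "i - 1" ?c "p i"] by (auto simp: p_def)
    have "run_time (reduced I D B) (?n + i) (p i) = ereal D"
      using run_time_dummy[of I D B "i - 1" "p i"] i False by (auto simp: p_def)
    moreover have "(\<Sum>j \<in> {j \<in> {1..?n}. S j = i}. run_time (reduced I D B) j (p i)) =
        ereal (\<Sum>j \<in> {j \<in> {1..?n}. S j = i}. time I i j)"
      unfolding sum_ereal[symmetric]
      by (rule sum.cong) (use lev i in \<open>auto simp: run_time_job\<close>)
    moreover have "?n + i \<notin> {j \<in> {1..?n}. S j = i}" using i by simp
    ultimately show ?thesis
      unfolding set using load[OF i] B by simp
  qed
  moreover have "1 \<le> cores (reduced I D B)" using c by simp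
  ultimately show ?thesis
    unfolding cache_yes_def cache_makespan_le[OF \<open>1 \<le> cores (reduced I D B)\<close>] reduced_simps by blast
qed

text \<open>
  The dummies lie on different cores, since \<open>2 * D > B\<close>. Hence the \<open>i\<close>-th dummy, counted from 0, forces at
  least \<open>2 ^ i\<close> cache on its core, and, as these amounts sum up to the total cache size, exactly
  \<open>2 ^ i\<close>.
\<close>

lemma sched_yes_reduced:
  assumes I: "sched_instance I" and yes: "cache_yes (reduced I D B)"
    and B: "bound I \<ge> 0 \<Longrightarrow> B = bound I + D \<and> bound I < D" "bound I < 0 \<Longrightarrow> B < 0" and D: "D > 0"
  shows "sched_yes I"
proof -
  let ?c = "machines I" and ?n = "jobs I" and ?R = "reduced I D B"
  have c: "1 \<le> ?c" using I by (simp add: sched_instance_def)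
  obtain p S where p: "cache_partition ?R p" and S: "S \<in> {1..?n + dummies I} \<rightarrow> {1..?c}"
    and load: "\<And>i. i \<in> {1..?c} \<Longrightarrow>
      (\<Sum>j \<in> {j \<in> {1..?n + dummies I}. S j = i}. run_time ?R j (p i)) \<le> ereal B"
    using yes c by (auto simp: cache_yes_def cache_makespan_le)
  have nonneg: "run_time ?R j (p i) \<ge> 0" if "j \<in> {1..?n + dummies I}" "i \<in> {1..?c}" for i j
    using cache_instance_reduced[OF I D, of B] p that
    by (auto simp: cache_instance_def cache_partition_def intro: less_imp_le)
  \<comment> \<open>Applied below to no job, a single dummy, two dummies, and a dummy together with
    the original jobs of its core.\<close>
  have part: "(\<Sum>j \<in> A. run_time ?R j (p i)) \<le> ereal B"
    if "i \<in> {1..?c}" "A \<subseteq> {j \<in> {1..?n + dummies I}. S j = i}" for A i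
    using that nonneg by (intro order_trans[OF sum_mono2 load]) auto
  have "0 \<le> ereal B" using part[of 1 "{}"] c by simp
  then have B: "B = bound I + D" "bound I < D" "bound I \<ge> 0"
    using B by (auto simp: not_le[symmetric])
  show ?thesis
  proof (cases "?n = 0")
    case True
    then show ?thesis using B c by (auto simp: sched_yes_def sched_makespan_le)
  next
    case False
    then have k: "dummies I = ?c" by (simp add: dummies_def)
    define core where "core i = S (Suc (?n + i))" for i
    have core: "core i \<in> {1..?c}" if "i < ?c" for i
      using S that by (auto simp: core_def k)
    have cache: "2 ^ i \<le> p (core i)" if "i < ?c" for i
      using part[OF core[OF that], of "{Suc (?n + i)}"] that
      by (auto simp: core_def k run_time_dummy not_less split: if_splits)
    have inj: "inj_on core {..<?c}"
    proof (rule inj_onI, rule ccontr)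
      fix i i' assume i: "i \<in> {..<?c}" "i' \<in> {..<?c}" "core i = core i'" "i \<noteq> i'"
      have "(\<Sum>j \<in> {Suc (?n + i), Suc (?n + i')}. run_time ?R j (p (core i))) \<le> ereal B"
        using i core by (intro part) (auto simp: core_def k)
      moreover have "\<not> p (core i) < 2 ^ i" "\<not> p (core i) < 2 ^ i'"
        using cache[of i] cache[of i'] i by (auto simp: not_less)
      ultimately show False using i(4) B by (simp add: run_time_dummy)
    qed
    have img: "core ` {..<?c} = {1..?c}"
      using core inj by (intro card_subset_eq) (auto simp: card_image)
    have "(\<Sum>i<?c. p (core i)) = (\<Sum>i \<in> {1..?c}. p i)"
      using sum.reindex[OF inj, of p] img by (simp add: comp_def)
    also have "\<dots> \<le> (\<Sum>i<?c. 2 ^ i)"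
      using p by (simp add: cache_partition_def k sum_powers)
    finally have "(\<Sum>i<?c. p (core i) - 2 ^ i) \<le> 0" by (simp add: sum_subtractf)
    moreover have "(\<Sum>i<?c. p (core i) - 2 ^ i) \<ge> 0" using cache by (intro sum_nonneg) auto
    ultimately have "(\<Sum>i<?c. p (core i) - 2 ^ i) = 0" by simp
    then have p_core: "p (core i) = 2 ^ i" if "i < ?c" for i
      using that cache by (subst (asm) sum_nonneg_eq_0_iff) auto
    \<comment> \<open>A job goes to the machine whose dummy shares its core; dummies count from 0,
      machines from 1.\<close>
    define S' where "S' j = Suc (inv_into {..<?c} core (S j))" for j
    have inv: "inv_into {..<?c} core (S j) < ?c" "core (inv_into {..<?c} core (S j)) = S j"
      if "j \<in> {1..?n}" for j
    proof -
      have "S j \<in> core ` {..<?c}" using S that by (auto simp: img)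
      from inv_into_into[OF this] f_inv_into_f[OF this]
      show "inv_into {..<?c} core (S j) < ?c" "core (inv_into {..<?c} core (S j)) = S j" by auto
    qed
    have "S' \<in> {1..?n} \<rightarrow> {1..?c}" using inv(1) by (auto simp: S'_def Suc_le_eq)
    moreover have "(\<Sum>j \<in> {j \<in> {1..?n}. S' j = i}. time I i j) \<le> bound I" if i: "i \<in> {1..?c}" for i
    proof -
      let ?J = "{j \<in> {1..?n}. S' j = i}"
      obtain m where m: "i = Suc m" "m < ?c" using i by (cases i) auto
      have "level ?c (p (core m)) = i"
        unfolding m(1) using m(2) p_core by (intro level_eq) auto
      then have "(\<Sum>j \<in> ?J. run_time ?R j (p (core m))) = (\<Sum>j \<in> ?J. ereal (time I i j))"
        using m by (intro sum.cong) (auto simp: run_time_job)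
      moreover have "run_time ?R (Suc (?n + m)) (p (core m)) = ereal D"
        using p_core m by (simp add: run_time_dummy)
      \<comment> \<open>Cancelling the dummy's \<open>D\<close> against
        \<open>B = bound I + D\<close> leaves the old bound for the original jobs.\<close>
      moreover have "(\<Sum>j \<in> insert (Suc (?n + m)) ?J. run_time ?R j (p (core m))) \<le> ereal B"
        using m core inv(2) by (intro part) (auto simp: core_def S'_def k)
      ultimately show ?thesis using B by simp
    qed
    ultimately show ?thesis unfolding sched_yes_def sched_makespan_le[OF c] by blast
  qed
qed

section \<open>Encodings\<close>

lemma nat_word_0 [simp]: "nat_word 0 = []"
  by (simp add: nat_word.simps)

text \<open>The least significant bit comes first, so the factor shifts the bits of \<open>b\<close>
  just past those of \<open>a\<close> and no carry occurs.\<close>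

lemma nat_word_append: "nat_word (a + 2 ^ length (nat_word a) * b) = nat_word a @ nat_word b"
proof (induction a rule: nat_word.induct)
  case (1 a)
  show ?case
  proof (cases "a = 0")
    case False
    let ?l = "length (nat_word (a div 2))"
    have w: "nat_word a = Bit (odd a) # nat_word (a div 2)"
      using False by (subst nat_word.simps) simp
    have "(a + 2 * (2 ^ ?l * b)) div 2 = a div 2 + 2 ^ ?l * b" by simp
    then show ?thesis
      unfolding w using False 1 by (subst nat_word.simps) (simp add: mult.assoc add.commute)
  qed simp
qed

lemma less_power_length_nat_word: "a < 2 ^ length (nat_word a)"
proof (induction a rule: nat_word.induct)
  case (1 a)
  show ?case
  proof (cases "a = 0")
    case False
    then have "nat_word a = Bit (odd a) # nat_word (a div 2)" by (subst nat_word.simps) simp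
    then show ?thesis using 1 False by simp
  qed simp
qed

lemma nat_word_1 [simp]: "nat_word (Suc 0) = [Bit True]"
  by (subst nat_word.simps) simp

lemma nat_word_power: "nat_word (2 ^ k) = replicate k (Bit False) @ [Bit True]"
proof (induction k)
  case (Suc k)
  then show ?case by (subst nat_word.simps) simp
qed simp

lemma nat_word_power_minus_1: "nat_word (2 ^ k - 1) = replicate k (Bit True)"
proof (induction k)
  case (Suc k)
  have "(2::nat) ^ Suc k - 1 = 2 * (2 ^ k - 1) + 1"
    unfolding power_Suc using one_le_power[of "2::nat" k] by arith
  moreover have "nat_word (2 * n + 1) = Bit True # nat_word n" for n
    by (subst nat_word.simps) simp
  ultimately show ?case using Suc by (simp only: replicate_Suc)
qed simp

lemma nat_word_symbols: "set (nat_word n) \<subseteq> range Bit"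
proof (induction n rule: nat_word.induct)
  case (1 n)
  show ?case
  proof (cases "n = 0")
    case False
    then have "nat_word n = Bit (odd n) # nat_word (n div 2)" by (subst nat_word.simps) simp
    then show ?thesis using 1 False by simp
  qed simp
qed

lemma int_word_symbols: "set (int_word z) \<subseteq> range Bit \<union> {Minus}"
  using nat_word_symbols by (auto simp: int_word_def)

lemma rat_word_symbols: "set (rat_word q) \<subseteq> range Bit \<union> {Minus, Slash}"
  using int_word_symbols[of "fst (quotient_of q)"] int_word_symbols[of "snd (quotient_of q)"]
  by (auto simp: rat_word_def)

lemma int_word_1 [simp]: "int_word 1 = [Bit True]"
  using nat_word_power[of 0] by (simp add: int_word_def)

lemma rat_word_of_nat: "rat_word (of_nat n) = nat_word n @ [Slash, Bit True]"
  using quotient_of_int[of "int n"] by (simp add: rat_word_def int_word_def)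

lemma rat_word_power: "rat_word (2 ^ k) = replicate k (Bit False) @ [Bit True, Slash, Bit True]"
  using rat_word_of_nat[of "2 ^ k"] by (simp add: nat_word_power)

lemma rat_word_power_minus_1: "rat_word (2 ^ k - 1) = replicate k (Bit True) @ [Slash, Bit True]"
  using rat_word_of_nat[of "2 ^ k - 1"] by (simp add: nat_word_power_minus_1[simplified] of_nat_diff)

text \<open>
  For \<open>M \<ge> 0\<close> the new bound is \<open>M + 2 ^ l\<close> where \<open>l\<close> is the number of bits of the numerator
  \<open>a\<close> of \<open>M\<close>: its numerator \<open>a + 2 ^ l * b\<close> is written by concatenating \<open>a\<close> and \<open>b\<close>,
  and it is still in lowest terms.
\<close>

lemma bound_word:
  fixes M :: rat
  defines "P \<equiv> int_word (fst (quotient_of M))" and "Q \<equiv> int_word (snd (quotient_of M))"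
  obtains B :: rat where "rat_word B = P @ Q @ Slash # Q"
    and "M \<ge> 0 \<Longrightarrow> B = M + 2 ^ length P \<and> M < 2 ^ length P" and "M < 0 \<Longrightarrow> B < 0"
proof -
  obtain a b where ab: "quotient_of M = (a, b)" by fastforce
  then have b: "b > 0" and cop: "coprime a b" and M: "M = of_int a / of_int b"
    using quotient_of_denom_pos quotient_of_coprime quotient_of_div by blast+
  let ?l = "length (nat_word (nat \<bar>a\<bar>))"
  \<comment> \<open>For negative \<open>a\<close> the term \<open>y\<close> is subtracted: absolute
    values still add up, and the copied \<open>Minus\<close> is the correct sign.\<close>
  define s :: int where "s = (if a < 0 then -1 else 1)"
  define y where "y = 2 ^ ?l * b"
  define z where "z = a + s * y"
  have "coprime z b"
    using cop gcd_add_mult[of b "s * 2 ^ ?l" a]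
    by (simp add: z_def y_def mult.assoc coprime_iff_gcd_eq_1 gcd.commute add.commute)
  then have q: "quotient_of (Fract z b) = (z, b)"
    using b by (simp add: quotient_of_Fract normalize_def coprime_imp_gcd_eq_1)
  have "y > 0" using b by (simp add: y_def)
  then have "\<bar>z\<bar> = \<bar>a\<bar> + y" and sgn: "z < 0 \<longleftrightarrow> a < 0"
    by (auto simp: z_def s_def)
  then have abs: "nat \<bar>z\<bar> = nat \<bar>a\<bar> + 2 ^ ?l * nat b"
    using b by (simp add: y_def nat_add_distrib nat_mult_distrib nat_power_eq)
  have B: "Fract z b = of_int z / of_int b" by (simp add: Fract_of_int_quotient)
  have "rat_word (Fract z b) = P @ Q @ Slash # Q"
    using b by (simp add: rat_word_def q P_def Q_def ab int_word_def abs sgn nat_word_append)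
  moreover have "Fract z b = M + 2 ^ length P \<and> M < 2 ^ length P" if "M \<ge> 0"
  proof
    have a: "a \<ge> 0" using that b by (simp add: M zero_le_divide_iff)
    then have l: "length P = ?l" by (simp add: P_def ab int_word_def)
    show "Fract z b = M + 2 ^ length P"
      unfolding B M l using a b by (simp add: z_def y_def s_def add_divide_distrib)
    have "a < int (2 ^ ?l)" using less_power_length_nat_word[of "nat \<bar>a\<bar>"] a by linarith
    then have "a < 2 ^ ?l" by simp
    also have "\<dots> \<le> 2 ^ ?l * b" using b by simp
    finally have "rat_of_int a < of_int (2 ^ ?l * b)" by (simp only: of_int_less_iff)
    then show "M < 2 ^ length P"
      using b by (simp add: M l divide_less_eq)
  qed
  moreover have "Fract z b < 0" if "M < 0"
    using that b sgn by (simp add: B M divide_less_0_iff)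
  ultimately show ?thesis using that by blast
qed

section \<open>Words of the constructed instance\<close>

lemma describes_levels:
  assumes "c \<ge> 1" "\<And>x. x < 1 \<Longrightarrow> g x = \<infinity>"
    and "\<And>i x. i < c \<Longrightarrow> 2 ^ i \<le> x \<Longrightarrow> (Suc i < c \<Longrightarrow> x < 2 ^ Suc i) \<Longrightarrow> g x = ereal (of_rat (t i))"
  shows "describes_step_function ((0, None) # map (\<lambda>i. (2 ^ i, Some (t i))) [0..<c]) g"
proof -
  have "sorted_wrt (<) (map (\<lambda>i. (2::rat) ^ i) [0..<c])"
    by (simp add: sorted_wrt_iff_nth_less)
  moreover have "\<forall>k<Suc c. \<forall>x :: real.
      of_rat (fst (((0, None) # map (\<lambda>i. (2 ^ i, Some (t i))) [0..<c]) ! k)) \<le> x \<and>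
      (Suc k < Suc c \<longrightarrow> x < of_rat (fst (((0, None) # map (\<lambda>i. (2 ^ i, Some (t i))) [0..<c]) ! Suc k))) \<longrightarrow>
      g x = step_value (snd (((0, None) # map (\<lambda>i. (2 ^ i, Some (t i))) [0..<c]) ! k))"
  proof (intro allI impI)
    fix k and x :: real
    assume k: "k < Suc c"
      and x: "of_rat (fst (((0, None) # map (\<lambda>i. (2 ^ i, Some (t i))) [0..<c]) ! k)) \<le> x \<and>
      (Suc k < Suc c \<longrightarrow> x < of_rat (fst (((0, None) # map (\<lambda>i. (2 ^ i, Some (t i))) [0..<c]) ! Suc k)))"
    show "g x = step_value (snd (((0, None) # map (\<lambda>i. (2 ^ i, Some (t i))) [0..<c]) ! k))"
    proof (cases k)
      case 0
      then show ?thesis using x assms(1,2) by (simp add: step_value_def)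
    next
      case (Suc i)
      then show ?thesis using x k assms(3)[of i x] by (simp add: step_value_def of_rat_power of_rat_mult)
    qed
  qed
  ultimately show ?thesis
    by (simp add: describes_step_function_def comp_def)
qed

lemma describes_threshold:
  assumes "\<And>x. g x = (if x < 2 ^ i then \<infinity> else ereal (of_rat d))"
  shows "describes_step_function [(0, None), (2 ^ i, Some d)] g"
  by (auto simp: describes_step_function_def assms step_value_def of_rat_power less_Suc_eq)

lemma rat_word_0 [simp]: "rat_word 0 = [Slash, Bit True]"
  using rat_word_of_nat[of 0] by simp

text \<open>Rows are indexed from 0 and machines from 1: index \<open>i\<close> stands for machine
  \<open>Suc i\<close> and breakpoint \<open>2 ^ i\<close>.\<close>

lemma step_list_word_job:
  "step_list_word ((0, None) # map (\<lambda>i. (2 ^ i, Some (t (Suc i)))) [0..<c]) @ [Semicolon] =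
    job_word (map (\<lambda>i. rat_word (t i)) [1..<Suc c])"
proof -
  have "map (\<lambda>i. breakpoint_word i @ rat_word (t (Suc i)) @ [Comma]) [0..<c] =
      map (\<lambda>i. breakpoint_word i @ map (\<lambda>i. rat_word (t i)) [1..<Suc c] ! i @ [Comma]) [0..<c]"
    by (rule map_cong) (auto simp del: upt_Suc)
  then show ?thesis
    by (simp add: job_word_def entries_word_def step_list_word_def value_word_def comp_def
        breakpoint_word_def rat_word_power del: upt_Suc map_eq_conv)
qed

lemma step_list_word_dummy:
  "step_list_word [(0, None), (2 ^ i, Some (2 ^ p))] @ [Semicolon] = dummy_word p i"
  by (simp add: dummy_word_def breakpoint_word_def step_list_word_def value_word_def rat_word_power)

text \<open>Passes from separators after each row, as in the encoding, to separators before it, as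
  in \<open>jobs_word\<close>.\<close>

lemma concat_separators:
  "concat (map (\<lambda>x. s # f x) xs) @ [s] = s # concat (map (\<lambda>x. f x @ [s]) xs)"
  by (induction xs) auto

definition job_words :: "(nat \<Rightarrow> nat \<Rightarrow> rat) \<Rightarrow> nat \<Rightarrow> nat \<Rightarrow> word list list" where
  "job_words T c n = map (\<lambda>j. map (\<lambda>i. rat_word (T i j)) [1..<Suc c]) [1..<Suc n]"

lemma sched_word_eq:
  "nat_word c @ [Semicolon]
     @ concat (map (\<lambda>j. concat (map (\<lambda>i. rat_word (T i j) @ [Comma]) [1..<Suc c]) @ [Semicolon]) [1..<Suc n])
     @ rat_word M =
   sched_word (nat_word c) (job_words T c n) (int_word (fst (quotient_of M))) (int_word (snd (quotient_of M)))"
  (is "?l = _")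
proof -
  have "?l = nat_word c @ (jobs_word (job_words T c n) @ [Semicolon]) @ rat_word M"
    unfolding jobs_word_def concat_separators
    by (simp add: job_words_def row_word_def comp_def del: upt_Suc)
  then show ?thesis by (simp add: sched_word_def rat_word_def)
qed

text \<open>The dummy value \<open>2 ^ length P\<close> is what a pass over the word
  \<open>P\<close> prints, a possible minus sign included.\<close>

lemma cache_encodes_reduced:
  assumes I: "1 \<le> machines I" "\<forall>i \<in> {1..machines I}. \<forall>j \<in> {1..jobs I}. time I i j = of_rat (T i j)"
    and B: "rat_word B = P @ Q @ Slash # Q"
  shows "cache_encodes (cache_word (nat_word (machines I)) (job_words T (machines I) (jobs I)) P Q (dummies I))
    (reduced I (2 ^ length P) (of_rat B))"
proof -
  let ?c = "machines I" and ?n = "jobs I" and ?k = "dummies I"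
  let ?R = "reduced I (2 ^ length P) (of_rat B)"
  define F :: "nat \<Rightarrow> step_list" where
    "F j = (if j \<le> ?n then (0, None) # map (\<lambda>i. (2 ^ i, Some (T (Suc i) j))) [0..<?c]
       else [(0, None), (2 ^ (j - Suc ?n), Some (2 ^ length P))])" for j
  have "describes_step_function (F j) (run_time ?R j)" if j: "j \<in> {1..cache_jobs ?R}" for j
  proof (cases "j \<le> ?n")
    case True
    have "run_time ?R j x = ereal (of_rat (T (Suc i) j))"
      if "i < ?c" "2 ^ i \<le> x" "Suc i < ?c \<Longrightarrow> x < 2 ^ Suc i" for i x
      using I(2) True j that level_eq[of i ?c x] by (simp add: run_time_job)
    then show ?thesis
      using True I(1) unfolding F_def
      by (auto intro!: describes_levels simp: run_time_job level_eq_0)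
  next
    case False
    then show ?thesis
      unfolding F_def using run_time_dummy[of I "2 ^ length P" "of_rat B" "j - Suc ?n"]
      by (auto intro!: describes_threshold simp: of_rat_power)
  qed
  moreover have "concat (map (\<lambda>j. step_list_word (F j) @ [Semicolon]) [1..<Suc (?n + ?k)]) =
      concat (map job_word (job_words T ?c ?n)) @ concat (map (dummy_word (length P)) [0..<?k])"
  proof -
    have "map (\<lambda>j. step_list_word (F j) @ [Semicolon]) [1..<Suc ?n] = map job_word (job_words T ?c ?n)"
      unfolding job_words_def map_map
      by (rule map_cong) (auto simp: F_def step_list_word_job[where t = "\<lambda>i. T i j" for j, unfolded One_nat_def]
          simp del: upt_Suc)
    moreover have "map (\<lambda>j. step_list_word (F j) @ [Semicolon]) [Suc ?n..<Suc ?n + ?k] =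
        map (dummy_word (length P)) [0..<?k]"
      by (rule nth_equalityI) (simp_all add: F_def step_list_word_dummy del: upt_Suc)
    moreover have "[1..<Suc (?n + ?k)] = [1..<Suc ?n] @ [Suc ?n..<Suc ?n + ?k]"
      using upt_add_eq_append[of 1 "Suc ?n" ?k] by simp
    ultimately show ?thesis by (simp del: upt_Suc)
  qed
  moreover have "cache_size ?R = of_rat (2 ^ ?k - 1)"
    by (simp add: of_rat_diff of_rat_power)
  ultimately show ?thesis
    unfolding cache_encodes_def
    by (intro exI[of _ "2 ^ ?k - 1"] exI[of _ B] exI[of _ F])
      (simp add: cache_word_def B rat_word_power_minus_1 del: upt_Suc)
qed

text \<open>The rational data read off from \<open>w\<close> determine both the output of the
  machine and the instance encoded by it.\<close>

lemma reduction_correct: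
  assumes I: "sched_instance I" and w: "sched_encodes w I"
  shows "\<exists>v y. computes_within reduction_tm w v (100 * (length w + 1) ^ 3) \<and> cache_instance y \<and>
    cache_encodes v y \<and> (sched_yes I \<longleftrightarrow> cache_yes y)"
proof -
  obtain T :: "nat \<Rightarrow> nat \<Rightarrow> rat" and M :: rat
    where T: "\<forall>i \<in> {1..machines I}. \<forall>j \<in> {1..jobs I}. time I i j = of_rat (T i j)"
      and M: "bound I = of_rat M"
      and w: "w = sched_word (nat_word (machines I)) (job_words T (machines I) (jobs I))
        (int_word (fst (quotient_of M))) (int_word (snd (quotient_of M)))"
    using w unfolding sched_encodes_def sched_word_eq by blast
  define P Q where "P = int_word (fst (quotient_of M))" and "Q = int_word (snd (quotient_of M))"
  obtain B where B: "rat_word B = P @ Q @ Slash # Q"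
    and nonneg: "M \<ge> 0 \<Longrightarrow> B = M + 2 ^ length P \<and> M < 2 ^ length P" and neg: "M < 0 \<Longrightarrow> B < 0"
    using bound_word[of M] unfolding P_def Q_def by blast
  let ?v = "cache_word (nat_word (machines I)) (job_words T (machines I) (jobs I)) P Q (dummies I)"
  let ?y = "reduced I (2 ^ length P) (of_rat B)"
  have c: "1 \<le> machines I" using I by (simp add: sched_instance_def)
  have nonneg': "of_rat B = bound I + 2 ^ length P \<and> bound I < 2 ^ length P" if "bound I \<ge> 0"
  proof -
    have "of_rat M < (of_rat (2 ^ length P) :: real)"
      using nonneg that unfolding of_rat_less by (simp add: M)
    then show ?thesis using nonneg that by (simp add: M of_rat_add of_rat_power)
  qed
  have neg': "of_rat B < (0::real)" if "bound I < 0" using neg that by (simp add: M)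
  have "computes_within reduction_tm w ?v (100 * (length w + 1) ^ 3)"
    unfolding w P_def[symmetric] Q_def[symmetric]
  proof (rule reduction_tm_computes)
    show "set (nat_word (machines I)) \<inter> {Comma, Semicolon} = {}"
      using nat_word_symbols by blast
    show "set P \<inter> {Comma, Semicolon, Slash} = {}" "set Q \<inter> {Comma, Semicolon, Slash} = {}"
      unfolding P_def Q_def using int_word_symbols by blast+
    have "set (rat_word q) \<inter> {Comma, Semicolon} = {}" for q
      using rat_word_symbols by blast
    then show "\<forall>vs \<in> set (job_words T (machines I) (jobs I)).
        set (concat vs) \<inter> {Comma, Semicolon} = {} \<and> vs \<noteq> [] \<and> length vs = dummies I"
      using c by (auto simp: job_words_def dummies_def simp del: upt_Suc)
    show "dummies I = 0" if "job_words T (machines I) (jobs I) = []"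
      using that by (auto simp: job_words_def dummies_def split: if_splits)
  qed
  moreover have "cache_instance ?y"
    using cache_instance_reduced[OF I] by simp
  moreover have "cache_encodes ?v ?y"
    by (rule cache_encodes_reduced[OF c T B])
  moreover have "sched_yes I \<longleftrightarrow> cache_yes ?y"
    using cache_yes_reduced[OF I, of "of_rat B" "2 ^ length P"]
      sched_yes_reduced[OF I, of "2 ^ length P" "of_rat B"] nonneg' neg' by auto
  ultimately show ?thesis by blast
qed

theorem theorem1:
  shows "poly_time_reducible ordered_unrelated_scheduling joint_cache_partition_assignment"
proof -
  \<comment> \<open>The function is taken from the machine itself; on encodings, uniqueness of the
    output fixes the choice.\<close>
  define f where "f w = (SOME v. \<exists>t. computes_within reduction_tm w v t)" for w
  have f: "f w = v" if "computes_within reduction_tm w v t" for w v t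
    unfolding f_def using that by (intro some_equality) (auto intro: computes_within_unique)
  define p :: "nat poly" where "p = [:100:] * [:1, 1:] ^ 3"
  have p: "poly p n = 100 * (n + 1) ^ 3" for n
    by (simp add: p_def poly_power)
  show ?thesis
    unfolding poly_time_reducible_def poly_time_computable_on_def
  proof (intro exI[of _ f] exI[of _ reduction_tm] exI[of _ p] conjI ballI allI impI)
    show "wf_tm reduction_tm" by (rule wf_reduction_tm)
    fix w assume "w \<in> {w. \<exists>x \<in> instances ordered_unrelated_scheduling.
      encodes ordered_unrelated_scheduling w x}"
    then obtain I where "sched_instance I" "sched_encodes w I"
      by (auto simp: ordered_unrelated_scheduling_def)
    from reduction_correct[OF this] show "computes_within reduction_tm w (f w) (poly p (length w))"
      unfolding p using f by blast
  next
    fix I w assume "I \<in> instances ordered_unrelated_scheduling"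
      "encodes ordered_unrelated_scheduling w I"
    then have I: "sched_instance I" "sched_encodes w I"
      by (auto simp: ordered_unrelated_scheduling_def)
    obtain y where "cache_instance y" "cache_encodes (f w) y" "sched_yes I \<longleftrightarrow> cache_yes y"
      using reduction_correct[OF I] f by metis
    then show "\<exists>y \<in> instances joint_cache_partition_assignment.
        encodes joint_cache_partition_assignment (f w) y \<and>
        (I \<in> yes_instances ordered_unrelated_scheduling \<longleftrightarrow>
         y \<in> yes_instances joint_cache_partition_assignment)"
      using I by (auto simp: ordered_unrelated_scheduling_def joint_cache_partition_assignment_def)
  qed
qed

end
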